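(* Let $A\in\mathbb{R}^{N\times N}$ be symmetric positive semidefinite of rank $K$, let $\mathcal{P}=\{P_m\}_{m=1}^M$ be a partition of $[N]$ that is regular-sparse with respect to $A$, and let $A=GG^T$, $G\in\mathbb{R}^{N\times K}$, be the decomposition produced by the ISMD procedure applied to $(A,\mathcal{P})$. Let $\Psi=[\psi_1,\dots,\psi_K]$ be an arbitrary set of intrinsic sparse modes of $A$ under $\mathcal{P}$, with columns ordered so that unidentifiable modes are grouped together: $\Psi=[\Psi_1,\dots,\Psi_Q]$, where $Q$ is the number of groups of unidentifiable modes and $n_q$ is the number of modes in $\Psi_q$. Then there exist $Q$ orthogonal matrices $U_q\in\mathbb{R}^{n_q\times n_q}$ ($1\le q\le Q$) such that, after reordering the columns of $G$ if necessary, $$G=[\Psi_1U_1,\dots,\Psi_QU_Q].$$ Consequently: (i) the columns of $G$ produced by the ISMD form a set of intrinsic sparse modes of $A$ under $\mathcal{P}$; (ii) the intrinsic sparse modes are unique up to permutations and rotations (multiplication on the right by orthogonal matrices) within groups of unidentifiable modes.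
   Context: **Basic notions.** $[N]=\{1,\dots,N\}$. $A\in\mathbb{R}^{N\times N}$ is symmetric positive semidefinite of rank $K$; $\mathcal{P}=\{P_m\}_{m=1}^M$ is a partition of $[N]$ into disjoint nonempty patches. For $\psi\in\mathbb{R}^N$, $\psi|_P\in\mathbb{R}^{|P|}$ is its restriction to $P$. The patch-wise sparseness is $s(\psi;\mathcal{P})=\#\{P\in\mathcal{P}:\psi|_P\ne 0\}$. A set of *intrinsic sparse modes* of $A$ under $\mathcal{P}$ is a minimizer $(\psi_1,\dots,\psi_K)$ of $\sum_{k=1}^K s(\psi_k;\mathcal{P})$ over all $\psi_1,\dots,\psi_K\in\mathbb{R}^N$ with $A=\sum_{k=1}^K\psi_k\psi_k^T$. The partition $\mathcal{P}$ is *regular-sparse with respect to $A$* if there is a decomposition $A=\sum_{k=1}^K g_kg_k^T$ (with $K$ the rank of $A$) such that for every patch $P_m$ the vectors among $g_1|_{P_m},\dots,g_K|_{P_m}$ belonging to modes that are nonzero on $P_m$ are linearly independent. Two modes $g,g'\in\mathbb{R}^N$ are *unidentifiable* on $\mathcal{P}$ if $\{P\in\mathcal{P}:g|_P\neq0\}=\{P\in\mathcal{P}:g'|_P\neq0\}$, and *identifiable* otherwise; the groups of unidentifiable modes are the equivalence classes of this relation. **ISMD (intrinsic sparse mode decomposition) procedure.** Order indices so that $A$ has blocks $A_{mn}$ (rows in $P_m$, columns in $P_n$). 1. For each $m$, let $K_m=\operatorname{rank}A_{mm}$, take an eigendecomposition $A_{mm}=\sum_{i=1}^{K_m}\gamma_{m,i}h_{m,i}h_{m,i}^T$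 with $\gamma_{m,i}>0$ and $h_{m,i}$ orthonormal, and put $H_m=[\gamma_{m,1}^{1/2}h_{m,1},\dots,\gamma_{m,K_m}^{1/2}h_{m,K_m}]$, so $A_{mm}=H_mH_m^T$. With $H_m^\dagger=(H_m^TH_m)^{-1}H_m^T$, let $\Lambda$ be the block matrix with blocks $\Lambda_{mn}=H_m^\dagger A_{mn}(H_n^\dagger)^T\in\mathbb{R}^{K_m\times K_n}$. With $H_{ext}=\operatorname{diag}\{H_1,\dots,H_M\}$ one has $A=H_{ext}\Lambda H_{ext}^T$. 2. For each $m$, let $\Sigma_{n;m}=\Lambda_{mn}\Lambda_{mn}^T$ and let $D_m$ be any (global) minimizer of $\sum_{n=1}^M\sum_{i\ne j}|(V^T\Sigma_{n;m}V)_{i,j}|^2$ over orthogonal matrices $V\in\mathbb{R}^{K_m\times K_m}$. Let $D=\operatorname{diag}\{D_1,\dots,D_M\}$, $\Omega=D^T\Lambda D$. 3. Take a pivoted Cholesky decomposition $\Omega=PLL^TP^T$, where $P$ is a permutation matrix and $L$ is a lower triangular (trapezoidal) matrix of size $(\sum_mK_m)\times K$ with positive diagonal entries. Output $G=H_{ext}DPL$, so that $A=GG^T$. *)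

theory Defs
  imports
    Complex_Main
    "HOL-Library.Disjoint_Sets"
    "HOL-Combinatorics.Permutations"
    "Jordan_Normal_Form.DL_Rank"
    "Jordan_Normal_Form.DL_Submatrix"
    "Jordan_Normal_Form.Gauss_Jordan_Elimination"
begin

text \<open>Vectors and matrices are those of \<^theory>\<open>Jordan_Normal_Form.Matrix\<close>, so
  dimensions are natural numbers, indices start at 0, and \<open>[N]\<close> is \<open>{0..<N}\<close>.\<close>

section \<open>Matrices\<close>

definition sym_psd :: "real mat \<Rightarrow> bool" where
  "sym_psd A \<longleftrightarrow> square_mat A \<and> transpose_mat A = A \<and>
     (\<forall>v \<in> carrier_vec (dim_row A). v \<bullet> (A *\<^sub>v v) \<ge> 0)"

text \<open>The library predicate \<^const>\<open>orthogonal_mat\<close> does not ask for normalised columns, so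
  it is not the usual notion of an orthogonal matrix.\<close>

definition orthogonal_matrix :: "nat \<Rightarrow> real mat \<Rightarrow> bool" where
  "orthogonal_matrix n U \<longleftrightarrow> U \<in> carrier_mat n n \<and> transpose_mat U * U = 1\<^sub>m n"

definition permutation_matrix :: "nat \<Rightarrow> real mat \<Rightarrow> bool" where
  "permutation_matrix n P \<longleftrightarrow>
     (\<exists>\<pi>. \<pi> permutes {..<n} \<and> P = mat n n (\<lambda>(i, j). if i = \<pi> j then 1 else 0))"

text \<open>Linear independence of a finite family: \<open>module.lin_dep\<close> is about the set of its
  members, so repetitions have to be excluded separately.\<close>

definition lin_indpt_family :: "nat \<Rightarrow> real vec list \<Rightarrow> bool" where
  "lin_indpt_family n vs \<longleftrightarrow> distinct vs \<and> set vs \<subseteq> carrier_vec n \<and>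
     \<not> module.lin_dep class_ring (module_vec TYPE(real) n) (set vs)"

definition permute_cols :: "(nat \<Rightarrow> nat) \<Rightarrow> real mat \<Rightarrow> real mat" where
  "permute_cols \<pi> B = mat (dim_row B) (dim_col B) (\<lambda>(i, j). B $$ (i, \<pi> j))"

text \<open>The matrix \<open>[B\<^sub>1, \<dots>, B\<^sub>Q]\<close> with \<open>N\<close> rows.\<close>

definition hconcat :: "nat \<Rightarrow> real mat list \<Rightarrow> real mat" where
  "hconcat N Bs = mat_of_cols N (concat (map cols Bs))"

section \<open>Intrinsic sparse modes\<close>

text \<open>Patches are given as a list \<open>Ps\<close>, so that they are numbered.\<close>

definition patch_partition :: "nat \<Rightarrow> nat set list \<Rightarrow> bool" where
  "patch_partition N Ps \<longleftrightarrow> distinct Ps \<and> partition_on {0..<N} (set Ps)"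

text \<open>\<^term>\<open>pick P a\<close> is the \<open>a\<close>-th smallest element of \<open>P\<close>, as in \<^const>\<open>submatrix\<close>.\<close>

definition restrict_vec :: "real vec \<Rightarrow> nat set \<Rightarrow> real vec" where
  "restrict_vec \<psi> P = vec (card P) (\<lambda>a. \<psi> $ pick P a)"

definition patch_support :: "nat set list \<Rightarrow> real vec \<Rightarrow> nat set set" where
  "patch_support Ps \<psi> = {P \<in> set Ps. restrict_vec \<psi> P \<noteq> 0\<^sub>v (card P)}"

definition sparseness :: "nat set list \<Rightarrow> real vec \<Rightarrow> nat" where
  "sparseness Ps \<psi> = card (patch_support Ps \<psi>)"

definition unidentifiable :: "nat set list \<Rightarrow> real vec \<Rightarrow> real vec \<Rightarrow> bool" where
  "unidentifiable Ps g g' \<longleftrightarrow> patch_support Ps g = patch_support Ps g'"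

text \<open>A family \<open>(\<psi>\<^sub>1, \<dots>, \<psi>\<^sub>K)\<close> is the matrix \<open>\<Psi>\<close> with these columns, so
  \<open>\<Sum>\<^sub>k \<psi>\<^sub>k \<psi>\<^sub>k\<^sup>T = \<Psi> \<Psi>\<^sup>T\<close>.\<close>

definition mode_decomposition :: "real mat \<Rightarrow> real mat \<Rightarrow> bool" where
  "mode_decomposition A \<Psi> \<longleftrightarrow>
     \<Psi> \<in> carrier_mat (dim_row A) (vec_space.rank (dim_row A) A) \<and>
     A = \<Psi> * transpose_mat \<Psi>"

definition intrinsic_sparse_modes :: "real mat \<Rightarrow> nat set list \<Rightarrow> real mat \<Rightarrow> bool" where
  "intrinsic_sparse_modes A Ps \<Psi> \<longleftrightarrow>
     is_arg_min (\<lambda>\<Psi>. \<Sum>k<dim_col \<Psi>. sparseness Ps (col \<Psi> k)) (mode_decomposition A) \<Psi>"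

definition regular_sparse :: "real mat \<Rightarrow> nat set list \<Rightarrow> bool" where
  "regular_sparse A Ps \<longleftrightarrow> (\<exists>g. mode_decomposition A g \<and>
     (\<forall>P \<in> set Ps. lin_indpt_family (card P)
        (filter (\<lambda>v. v \<noteq> 0\<^sub>v (card P)) (map (\<lambda>\<psi>. restrict_vec \<psi> P) (cols g)))))"

text \<open>\<open>\<Psi>s = [\<Psi>\<^sub>1, \<dots>, \<Psi>\<^sub>Q]\<close> lists the modes group by group: each \<open>\<Psi>\<^sub>q\<close> consists of all the
  modes of one equivalence class of unidentifiable modes.\<close>

definition grouped_modes :: "nat \<Rightarrow> nat set list \<Rightarrow> real mat list \<Rightarrow> bool" where
  "grouped_modes N Ps \<Psi>s \<longleftrightarrow>
     (\<forall>q<length \<Psi>s. dim_row (\<Psi>s ! q) = N \<and> dim_col (\<Psi>s ! q) > 0) \<and>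
     (\<forall>q<length \<Psi>s. \<forall>q'<length \<Psi>s.
        \<forall>j<dim_col (\<Psi>s ! q). \<forall>j'<dim_col (\<Psi>s ! q').
          unidentifiable Ps (col (\<Psi>s ! q) j) (col (\<Psi>s ! q') j') \<longleftrightarrow> q = q')"

text \<open>\<open>Us = [U\<^sub>1, \<dots>, U\<^sub>Q]\<close> with \<open>U\<^sub>q\<close> orthogonal of size \<open>n\<^sub>q \<times> n\<^sub>q\<close>; the second definition
  is \<open>[\<Psi>\<^sub>1 U\<^sub>1, \<dots>, \<Psi>\<^sub>Q U\<^sub>Q]\<close>.\<close>

definition group_rotations :: "real mat list \<Rightarrow> real mat list \<Rightarrow> bool" where
  "group_rotations \<Psi>s Us \<longleftrightarrow> length Us = length \<Psi>s \<and>
     (\<forall>q<length \<Psi>s. orthogonal_matrix (dim_col (\<Psi>s ! q)) (Us ! q))"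

definition rotate_groups :: "nat \<Rightarrow> real mat list \<Rightarrow> real mat list \<Rightarrow> real mat" where
  "rotate_groups N \<Psi>s Us = hconcat N (map2 (*) \<Psi>s Us)"

section \<open>The ISMD procedure\<close>

definition patch_block :: "real mat \<Rightarrow> nat set list \<Rightarrow> nat \<Rightarrow> nat \<Rightarrow> real mat" where
  "patch_block A Ps m n = submatrix A (Ps ! m) (Ps ! n)"

text \<open>Row \<open>r\<close> in the ordering in which the patches are contiguous is row
  \<open>patch_order Ps ! r\<close> in the original ordering.\<close>

definition patch_order :: "nat set list \<Rightarrow> nat list" where
  "patch_order Ps = concat (map (\<lambda>P. map (pick P) [0..<card P]) Ps)"

definition rows_by_patch :: "nat set list \<Rightarrow> real mat \<Rightarrow> real mat" where
  "rows_by_patch Ps B =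
     mat (length (patch_order Ps)) (dim_col B) (\<lambda>(r, k). B $$ (patch_order Ps ! r, k))"

text \<open>The square block matrix with blocks \<open>B m n\<close> of size \<open>ks ! m \<times> ks ! n\<close>;
  \<open>block_indices ks\<close> enumerates its row (column) indices as pairs (block, index in block).\<close>

definition block_indices :: "nat list \<Rightarrow> (nat \<times> nat) list" where
  "block_indices ks = concat (map (\<lambda>m. map (Pair m) [0..<ks ! m]) [0..<length ks])"

definition block_matrix :: "nat list \<Rightarrow> (nat \<Rightarrow> nat \<Rightarrow> real mat) \<Rightarrow> real mat" where
  "block_matrix ks B = mat (sum_list ks) (sum_list ks)
     (\<lambda>(i, j). let (m, a) = block_indices ks ! i; (n, b) = block_indices ks ! j
               in B m n $$ (a, b))"

text \<open>\<open>B = \<Sum>\<^sub>i \<gamma>\<^sub>i h\<^sub>i h\<^sub>i\<^sup>T\<close>, summing over \<open>i < r\<close>.\<close>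

definition eigendecomposition :: "real mat \<Rightarrow> nat \<Rightarrow> (nat \<Rightarrow> real) \<Rightarrow> (nat \<Rightarrow> real vec) \<Rightarrow> bool" where
  "eigendecomposition B r \<gamma> h \<longleftrightarrow>
     (\<forall>i<r. \<gamma> i > 0 \<and> h i \<in> carrier_vec (dim_row B)) \<and>
     (\<forall>i<r. \<forall>j<r. h i \<bullet> h j = (if i = j then 1 else 0)) \<and>
     B = mat (dim_row B) (dim_row B) (\<lambda>(a, b). \<Sum>i<r. \<gamma> i * (h i $ a) * (h i $ b))"

definition eigen_factor :: "real mat \<Rightarrow> real mat \<Rightarrow> bool" where
  "eigen_factor B H \<longleftrightarrow> (\<exists>\<gamma> h. let r = vec_space.rank (dim_row B) B in
     eigendecomposition B r \<gamma> h \<and>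
     H = mat_of_cols (dim_row B) (map (\<lambda>i. sqrt (\<gamma> i) \<cdot>\<^sub>v h i) [0..<r]))"

text \<open>\<open>H\<^sup>\<dagger> = (H\<^sup>T H)\<^sup>-\<^sup>1 H\<^sup>T\<close>, used for \<open>H\<close> of full column rank only.\<close>

definition left_pinv :: "real mat \<Rightarrow> real mat" where
  "left_pinv H = the (mat_inverse (transpose_mat H * H)) * transpose_mat H"

definition Lambda_block :: "real mat \<Rightarrow> nat set list \<Rightarrow> real mat list \<Rightarrow> nat \<Rightarrow> nat \<Rightarrow> real mat" where
  "Lambda_block A Ps Hs m n =
     left_pinv (Hs ! m) * patch_block A Ps m n * transpose_mat (left_pinv (Hs ! n))"

definition Lambda_mat :: "real mat \<Rightarrow> nat set list \<Rightarrow> real mat list \<Rightarrow> real mat" where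
  "Lambda_mat A Ps Hs = block_matrix (map dim_col Hs) (Lambda_block A Ps Hs)"

definition offdiag_sq :: "real mat \<Rightarrow> real" where
  "offdiag_sq B = (\<Sum>(i, j) | i < dim_row B \<and> j < dim_col B \<and> i \<noteq> j. \<bar>B $$ (i, j)\<bar>\<^sup>2)"

text \<open>\<open>D\<close> jointly diagonalises the matrices \<open>\<Sigma>\<^sub>n\<^sub>;\<^sub>m\<close>, \<open>n < M\<close>, of size \<open>k \<times> k\<close>, as well as possible.\<close>

definition joint_diagonalizer :: "nat \<Rightarrow> nat \<Rightarrow> (nat \<Rightarrow> real mat) \<Rightarrow> real mat \<Rightarrow> bool" where
  "joint_diagonalizer k M \<Sigma> D \<longleftrightarrow>
     is_arg_min (\<lambda>V. \<Sum>n<M. offdiag_sq (transpose_mat V * \<Sigma> n * V)) (orthogonal_matrix k) D"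

definition pivoted_cholesky :: "real mat \<Rightarrow> nat \<Rightarrow> real mat \<Rightarrow> real mat \<Rightarrow> bool" where
  "pivoted_cholesky \<Omega> K P L \<longleftrightarrow>
     permutation_matrix (dim_row \<Omega>) P \<and>
     L \<in> carrier_mat (dim_row \<Omega>) K \<and> K \<le> dim_row \<Omega> \<and>
     (\<forall>i<dim_row \<Omega>. \<forall>j<K. i < j \<longrightarrow> L $$ (i, j) = 0) \<and>
     (\<forall>k<K. L $$ (k, k) > 0) \<and>
     \<Omega> = P * L * transpose_mat L * transpose_mat P"

text \<open>The procedure involves choices (eigendecompositions, minimizers, pivots), so its outputs
  form a relation. The product \<open>H\<^sub>e\<^sub>x\<^sub>t D P L\<close> has its rows in the patch ordering, while \<open>G\<close> has
  them in the original ordering.\<close>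

definition ismd_output :: "real mat \<Rightarrow> nat set list \<Rightarrow> real mat \<Rightarrow> bool" where
  "ismd_output A Ps G \<longleftrightarrow> (\<exists>Hs Ds P L.
     let M = length Ps;
         K = vec_space.rank (dim_row A) A;
         \<Lambda> = Lambda_mat A Ps Hs;
         D = diag_block_mat Ds;
         \<Omega> = transpose_mat D * \<Lambda> * D
     in length Hs = M \<and> (\<forall>m<M. eigen_factor (patch_block A Ps m m) (Hs ! m)) \<and>
        length Ds = M \<and>
        (\<forall>m<M. joint_diagonalizer (dim_col (Hs ! m)) M
           (\<lambda>n. Lambda_block A Ps Hs m n * transpose_mat (Lambda_block A Ps Hs m n)) (Ds ! m)) \<and>
        pivoted_cholesky \<Omega> K P L \<and>
        G \<in> carrier_mat (dim_row A) K \<and>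
        rows_by_patch Ps G = diag_block_mat Hs * D * P * L)"

end

theory Submission
  imports Defs
begin

text \<open>If \<open>g\<close> is a regular-sparse decomposition, any other decomposition with \<open>K\<close> modes is \<open>g U\<close> with
  \<open>U\<close> orthogonal. A mode of \<open>g U\<close> that vanishes on a patch has zero coefficients at all the modes of
  \<open>g\<close> active on that patch, so summing squares of entries of \<open>U\<close> shows that \<open>g U\<close> has at least as many
  active modes on the patch as \<open>g\<close>. Equality on every patch forces \<open>U\<close> to connect only modes with
  the same patch support. Hence two families of intrinsic sparse modes differ by a block rotation.

  For the procedure, write \<open>g = H\<^sub>e\<^sub>x\<^sub>t L\<close>. Exact joint diagonalisation is possible, and it makes
  each row of \<open>W = D\<^sup>T L\<close> an eigenvector of every diagonal 0/1 matrix \<open>E\<close> that selects the modes active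
  on one patch. Since \<open>\<Omega> = W W\<^sup>T\<close>, the Cholesky factor is \<open>W U\<close> with \<open>U\<close> orthogonal; its triangular
  shape makes \<open>U\<^sup>T E U\<close> lower triangular, and symmetry makes it diagonal. So the columns of \<open>U\<close> do not
  mix modes with different supports, and \<open>G = g U\<close> is no less sparse than \<open>g\<close>.\<close>

section \<open>Orthogonal matrices and Gram matrices\<close>

text \<open>One fact carries the whole argument: if \<open>X X^T = Y Y^T\<close> and
  \<open>Z X = 1\<close>, then \<open>Y = X (Z Y)\<close> and the rows of \<open>Z Y\<close> are
  orthonormal. It is used three times. For \<open>X = g\<close>, regularity kills a coefficient on
  any patch where its mode is active, and \<open>K\<close> being the rank of \<open>A\<close>
  excludes zero modes, so a left inverse exists. For \<open>X = H_m\<close> the left inverse is the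
  pseudoinverse, and \<open>Z Y\<close> is the coordinate block \<open>L_m\<close>. For the stack
  \<open>W\<close> of all \<open>D_m^T L_m\<close>, the matrix \<open>W^T W\<close> is diagonal and
  its entries count the patches on which a mode is active.

  The 0/1 matrices come from regularity as well: \<open>L_m^T L_m\<close> is the indicator
  \<open>E_m\<close> of the modes active on patch \<open>m\<close>, so \<open>\<Sigma>\<close> for
  the pair \<open>(n, m)\<close> equals \<open>L_m E_n L_m^T\<close>.

  The obstacle is that \<open>D_m\<close> is any minimizer. Modes with the same support are not told
  apart by these matrices, so \<open>D_m\<close> is free to rotate them, and the rows of
  \<open>W\<close> need not be signed unit vectors. That each row is an eigenvector of every
  \<open>E_n\<close> survives this freedom and is all that the Cholesky step requires.\<close>

lemma orthogonal_matrix_right: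
  assumes "orthogonal_matrix n U"
  shows "U * transpose_mat U = 1\<^sub>m n"
  using assms mat_mult_left_right_inverse[of "transpose_mat U" n U]
  unfolding orthogonal_matrix_def by auto

lemma orthogonal_matrix_transpose:
  assumes "orthogonal_matrix n U"
  shows "orthogonal_matrix n (transpose_mat U)"
  using assms orthogonal_matrix_right[OF assms] unfolding orthogonal_matrix_def by auto

lemma orthogonal_matrix_mult:
  assumes "orthogonal_matrix n U" "orthogonal_matrix n V"
  shows "orthogonal_matrix n (U * V)"
proof -
  have U: "U \<in> carrier_mat n n" "transpose_mat U * U = 1\<^sub>m n"
    and V: "V \<in> carrier_mat n n" "transpose_mat V * V = 1\<^sub>m n"
    using assms unfolding orthogonal_matrix_def by auto
  have "transpose_mat (U * V) * (U * V) = transpose_mat V * (transpose_mat U * (U * V))"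
    using U V by (simp add: transpose_mult[OF U(1) V(1)] assoc_mult_mat[of _ n n _ n _ n])
  also have "\<dots> = transpose_mat V * ((transpose_mat U * U) * V)"
    using U(1) V(1) by (subst assoc_mult_mat[of _ n n _ n _ n]) auto
  finally show ?thesis using U V unfolding orthogonal_matrix_def by auto
qed

lemma index_mult_mat_sum:
  assumes "A \<in> carrier_mat n m" "B \<in> carrier_mat m p" "i < n" "j < p"
  shows "(A * B) $$ (i, j) = (\<Sum>k<m. A $$ (i, k) * B $$ (k, j))"
  using assms by (auto simp: scalar_prod_def lessThan_atLeast0 intro!: sum.cong)

lemma orthogonal_matrix_row_sum:
  assumes "orthogonal_matrix n U" "i < n" "j < n"
  shows "(\<Sum>k<n. U $$ (i, k) * U $$ (j, k)) = (if i = j then 1 else 0)"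
proof -
  have U: "U \<in> carrier_mat n n" using assms unfolding orthogonal_matrix_def by auto
  have "(U * transpose_mat U) $$ (i, j) = (\<Sum>k<n. U $$ (i, k) * U $$ (j, k))"
    using U assms by (subst index_mult_mat_sum[of _ n n _ n]) auto
  thus ?thesis using orthogonal_matrix_right[OF assms(1)] assms by simp
qed

lemma orthogonal_matrixI:
  assumes U: "U \<in> carrier_mat n n"
    and "\<And>i j. i < n \<Longrightarrow> j < n \<Longrightarrow> (\<Sum>k<n. U $$ (i, k) * U $$ (j, k)) = (if i = j then 1 else 0)"
  shows "orthogonal_matrix n U"
proof -
  have "U * transpose_mat U = 1\<^sub>m n"
  proof (rule eq_matI)
    fix i j assume "i < dim_row (1\<^sub>m n :: real mat)" "j < dim_col (1\<^sub>m n :: real mat)"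
    thus "(U * transpose_mat U) $$ (i, j) = 1\<^sub>m n $$ (i, j)"
      using U assms(2)[of i j] by (subst index_mult_mat_sum[of _ n n _ n]) auto
  qed (use U in auto)
  thus ?thesis using U mat_mult_left_right_inverse[of U n "transpose_mat U"]
    unfolding orthogonal_matrix_def by auto
qed

text \<open>Double counting of squared entries: each row in \<open>S\<close> has its whole unit mass
  inside the columns \<open>T\<close>, and these columns carry total mass \<open>card T\<close>. If
  the cardinalities agree, no mass is left there for rows outside \<open>S\<close>.\<close>

lemma orthogonal_matrix_zero_block:
  assumes U: "orthogonal_matrix n U" and S: "S \<subseteq> {..<n}" and T: "T \<subseteq> {..<n}"
    and zero: "\<And>k j. k \<in> S \<Longrightarrow> j < n \<Longrightarrow> j \<notin> T \<Longrightarrow> U $$ (k, j) = 0"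
  shows "card S \<le> card T"
    and "card S = card T \<Longrightarrow> k < n \<Longrightarrow> k \<notin> S \<Longrightarrow> j \<in> T \<Longrightarrow> U $$ (k, j) = 0"
proof -
  have UT: "orthogonal_matrix n (transpose_mat U)" and Uc: "U \<in> carrier_mat n n"
    using U orthogonal_matrix_transpose unfolding orthogonal_matrix_def by auto
  have row: "(\<Sum>j\<in>T. (U $$ (k, j))\<^sup>2) = 1" if "k \<in> S" for k
  proof -
    have "(\<Sum>j\<in>T. (U $$ (k, j))\<^sup>2) = (\<Sum>j<n. (U $$ (k, j))\<^sup>2)"
      using T zero[OF that] by (intro sum.mono_neutral_left) auto
    thus ?thesis using orthogonal_matrix_row_sum[OF U, of k k] that S
      by (auto simp: power2_eq_square)
  qed
  have col: "(\<Sum>k<n. (U $$ (k, j))\<^sup>2) = 1" if "j < n" for j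
    using orthogonal_matrix_row_sum[OF UT that that] that Uc by (simp add: power2_eq_square)
  have split: "real (card T) = (\<Sum>k\<in>S. \<Sum>j\<in>T. (U $$ (k, j))\<^sup>2) + (\<Sum>k\<in>{..<n}-S. \<Sum>j\<in>T. (U $$ (k, j))\<^sup>2)"
  proof -
    have "real (card T) = (\<Sum>j\<in>T. \<Sum>k<n. (U $$ (k, j))\<^sup>2)"
      using T col by (simp add: subset_eq)
    also have "\<dots> = (\<Sum>k<n. \<Sum>j\<in>T. (U $$ (k, j))\<^sup>2)" by (rule sum.swap)
    finally show ?thesis using sum.subset_diff[OF S] by (simp add: add.commute)
  qed
  have S1: "(\<Sum>k\<in>S. \<Sum>j\<in>T. (U $$ (k, j))\<^sup>2) = real (card S)" using row by simp
  have nn: "(\<Sum>k\<in>{..<n}-S. \<Sum>j\<in>T. (U $$ (k, j))\<^sup>2) \<ge> 0" by (intro sum_nonneg) auto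
  show "card S \<le> card T" using split S1 nn by linarith
  assume c: "card S = card T" and k: "k < n" "k \<notin> S" and j: "j \<in> T"
  have "finite T" using T finite_subset by blast
  have "(\<Sum>k\<in>{..<n}-S. \<Sum>j\<in>T. (U $$ (k, j))\<^sup>2) = 0" using split S1 c by simp
  hence "\<forall>k\<in>{..<n}-S. (\<Sum>j\<in>T. (U $$ (k, j))\<^sup>2) = 0"
    by (subst (asm) sum_nonneg_eq_0_iff) (auto intro: sum_nonneg)
  hence "(\<Sum>j\<in>T. (U $$ (k, j))\<^sup>2) = 0" using k by auto
  thus "U $$ (k, j) = 0" using j \<open>finite T\<close> by (subst (asm) sum_nonneg_eq_0_iff) auto
qed

section \<open>Factors with equal Gram matrices, and left inverses\<close>

lemma mult_transpose_self_eq_0: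
  fixes B :: "real mat"
  assumes "B \<in> carrier_mat n m" "B * transpose_mat B = 0\<^sub>m n n"
  shows "B = 0\<^sub>m n m"
proof (rule eq_matI)
  fix i j assume ij: "i < dim_row (0\<^sub>m n m :: real mat)" "j < dim_col (0\<^sub>m n m :: real mat)"
  have "(\<Sum>k<m. (B $$ (i, k))\<^sup>2) = (B * transpose_mat B) $$ (i, i)"
    using assms(1) ij by (subst index_mult_mat_sum[of _ n m _ n]) (auto simp: power2_eq_square)
  hence "(\<Sum>k<m. (B $$ (i, k))\<^sup>2) = 0" using assms(2) ij by simp
  hence "B $$ (i, j) = 0" using ij by (subst (asm) sum_nonneg_eq_0_iff) auto
  thus "B $$ (i, j) = 0\<^sub>m n m $$ (i, j)" using ij by simp
qed (use assms in auto)

text \<open>From \<open>Z Y Y^T = Z X X^T = X^T\<close> the defect \<open>D = Y - X (Z Y)\<close>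
  satisfies \<open>D Y^T = 0\<close>. Since \<open>D^T\<close> is \<open>Y^T\<close> times a matrix,
  also \<open>D D^T = 0\<close>, hence \<open>D = 0\<close>. The factor \<open>Z Y\<close> may have
  more columns than rows; this happens for patch coordinates.\<close>

lemma gram_eq_left_inverse:
  fixes X Y Z :: "real mat"
  assumes X: "X \<in> carrier_mat n r" and Y: "Y \<in> carrier_mat n s" and Z: "Z \<in> carrier_mat r n"
    and ZX: "Z * X = 1\<^sub>m r" and gram: "X * transpose_mat X = Y * transpose_mat Y"
  shows "X * (Z * Y) = Y" "(Z * Y) * transpose_mat (Z * Y) = 1\<^sub>m r"
proof -
  define D where "D = Y - X * (Z * Y)"
  have D: "D \<in> carrier_mat n s" unfolding D_def using X Y Z by auto
  have YT: "transpose_mat Y \<in> carrier_mat s n" and XT: "transpose_mat X \<in> carrier_mat r n" using X Y by auto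
  have ZYY: "Z * Y * transpose_mat Y = transpose_mat X"
  proof -
    have "Z * Y * transpose_mat Y = Z * (X * transpose_mat X)"
      using gram assoc_mult_mat[OF Z Y YT] by simp
    also have "\<dots> = Z * X * transpose_mat X" using assoc_mult_mat[OF Z X XT] by simp
    finally show ?thesis using ZX X by auto
  qed
  have ZY: "Z * Y \<in> carrier_mat r s" using Z Y by auto
  have "X * (Z * Y) * transpose_mat Y = X * transpose_mat X"
    using assoc_mult_mat[OF X ZY YT] ZYY by simp
  hence DY: "D * transpose_mat Y = 0\<^sub>m n n"
    unfolding D_def using X Y ZY YT
    by (subst minus_mult_distrib_mat[of _ n s _ _ n]) (auto simp: gram)
  \<comment> \<open>This form exposes the left factor \<open>Y^T\<close>, which \<open>D\<close>
    annihilates.\<close>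
  have "transpose_mat D = transpose_mat Y - transpose_mat Y * transpose_mat (X * Z)"
  proof -
    have "D = Y - X * Z * Y" unfolding D_def assoc_mult_mat[OF X Z Y] by simp
    hence "transpose_mat D = transpose_mat Y - transpose_mat (X * Z * Y)"
      by (simp only: transpose_minus[of Y n s] Y mult_carrier_mat[OF mult_carrier_mat[OF X Z] Y])
    thus ?thesis by (simp only: transpose_mult[OF mult_carrier_mat[OF X Z] Y])
  qed
  hence "D * transpose_mat D = D * transpose_mat Y - D * (transpose_mat Y * transpose_mat (X * Z))"
    using D X Y Z by (simp add: mult_minus_distrib_mat[of _ n s _ n])
  also have "D * (transpose_mat Y * transpose_mat (X * Z)) = D * transpose_mat Y * transpose_mat (X * Z)"
    using D X Y Z by (intro assoc_mult_mat[symmetric, of _ n s _ n _ n]) auto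
  finally have "D * transpose_mat D = 0\<^sub>m n n" using X Z by (simp add: DY)
  hence D0: "D = 0\<^sub>m n s" using D mult_transpose_self_eq_0 by blast
  show "X * (Z * Y) = Y"
  proof (rule eq_matI)
    fix i j assume "i < dim_row Y" "j < dim_col Y"
    hence ij: "i < n" "j < s" using Y by auto
    have "D $$ (i, j) = Y $$ (i, j) - (X * (Z * Y)) $$ (i, j)"
      unfolding D_def using ij X ZY by (intro index_minus_mat) auto
    thus "(X * (Z * Y)) $$ (i, j) = Y $$ (i, j)" using D0 ij by simp
  qed (use X Y Z in auto)
  have "Z * Y * transpose_mat (Z * Y) = Z * Y * (transpose_mat Y * transpose_mat Z)"
    using Z Y by (simp add: transpose_mult)
  also have "\<dots> = transpose_mat X * transpose_mat Z"
    using ZYY assoc_mult_mat[OF ZY YT, of "transpose_mat Z" r] Z by simp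
  also have "\<dots> = transpose_mat (Z * X)" using Z X by (simp add: transpose_mult)
  finally show "(Z * Y) * transpose_mat (Z * Y) = 1\<^sub>m r" using ZX by simp
qed

text \<open>The matrix \<open>X^T X\<close> is invertible, because \<open>v^T X^T X v\<close> is the
  squared norm of \<open>X v\<close>. The left inverse is then the one of the normal
  equations.\<close>

lemma left_inverse_exists:
  fixes X :: "real mat"
  assumes X: "X \<in> carrier_mat n r"
    and inj: "\<And>v. v \<in> carrier_vec r \<Longrightarrow> X *\<^sub>v v = 0\<^sub>v n \<Longrightarrow> v = 0\<^sub>v r"
  obtains Z where "Z \<in> carrier_mat r n" "Z * X = 1\<^sub>m r"
proof -
  let ?M = "transpose_mat X * X"
  have M: "?M \<in> carrier_mat r r" using X by auto
  have "v = 0\<^sub>v r" if v: "v \<in> carrier_vec r" and Mv: "?M *\<^sub>v v = 0\<^sub>v r" for v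
  proof (rule inj[OF v])
    let ?u = "X *\<^sub>v v"
    have u: "?u \<in> carrier_vec n" using X v by auto
    have "?u \<bullet> ?u = (transpose_mat X *\<^sub>v ?u) \<bullet> v"
      using X v u by (metis transpose_vec_mult_scalar comm_scalar_prod mult_mat_vec_carrier transpose_carrier_mat)
    also have "transpose_mat X *\<^sub>v ?u = 0\<^sub>v r" using Mv X v by simp
    finally have "?u \<bullet> ?u = 0" using v by simp
    hence "(\<Sum>i\<in>{0..<n}. ?u $ i * ?u $ i) = 0"
      using u unfolding scalar_prod_def by (simp only: carrier_vecD)
    hence "\<forall>i\<in>{0..<n}. ?u $ i * ?u $ i = 0"
      by (subst (asm) sum_nonneg_eq_0_iff) (auto simp del: mult_eq_0_iff)
    thus "?u = 0\<^sub>v n" using u X by (intro eq_vecI) (auto simp del: index_mult_mat_vec)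
  qed
  hence "det ?M \<noteq> 0" using det_0_iff_vec_prod_zero_field[OF M] by auto
  then obtain B where B: "B \<in> carrier_mat r r" "B * ?M = 1\<^sub>m r"
    using det_non_zero_imp_unit[OF M, of "()"] unfolding Units_def ring_mat_def by auto
  show ?thesis
    by (rule that[of "B * transpose_mat X"]) (use B X in \<open>auto simp: assoc_mult_mat[of B r r _ n X r]\<close>)
qed

section \<open>Minimality of regular-sparse decompositions\<close>

definition patch_rows :: "real mat \<Rightarrow> nat set \<Rightarrow> real mat" where
  "patch_rows B P = mat (card P) (dim_col B) (\<lambda>(a, k). B $$ (pick P a, k))"

definition active_modes :: "real mat \<Rightarrow> nat set \<Rightarrow> nat set" where
  "active_modes B P = {k. k < dim_col B \<and> restrict_vec (col B k) P \<noteq> 0\<^sub>v (card P)}"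

text \<open>Linear independence in coefficient form. The relation runs over all modes, since
  inactive ones contribute only zeros and their coefficients stay free. Columns of a matrix can thus
  be inserted directly as \<open>c\<close>.\<close>

definition regular_modes :: "nat set list \<Rightarrow> real mat \<Rightarrow> bool" where
  "regular_modes Ps g \<longleftrightarrow> (\<forall>P\<in>set Ps. \<forall>c.
     (\<forall>a<card P. (\<Sum>k<dim_col g. g $$ (pick P a, k) * c k) = 0) \<longrightarrow> (\<forall>k\<in>active_modes g P. c k = 0))"

lemma regular_modesD:
  assumes "regular_modes Ps g" "P \<in> set Ps"
    and "\<And>a. a < card P \<Longrightarrow> (\<Sum>k<dim_col g. g $$ (pick P a, k) * c k) = 0" "k \<in> active_modes g P"
  shows "c k = 0"
  using assms unfolding regular_modes_def by blast

lemma patch_rows_carrier [simp]: "B \<in> carrier_mat N K \<Longrightarrow> patch_rows B P \<in> carrier_mat (card P) K"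
  unfolding patch_rows_def by auto

lemma active_modes_subset: "B \<in> carrier_mat N K \<Longrightarrow> active_modes B P \<subseteq> {..<K}"
  unfolding active_modes_def by auto

lemma patch_partitionD:
  assumes "patch_partition N Ps"
  shows "distinct Ps" "P \<in> set Ps \<Longrightarrow> P \<subseteq> {0..<N}" "P \<in> set Ps \<Longrightarrow> P \<noteq> {}"
    "P \<in> set Ps \<Longrightarrow> finite P" "\<Union>(set Ps) = {0..<N}"
  using assms unfolding patch_partition_def partition_on_def
  by (auto intro: finite_subset[of _ "{0..<N}"])

lemma pick_less:
  assumes "patch_partition N Ps" "P \<in> set Ps" "a < card P"
  shows "pick P a < N"
  using patch_partitionD(2)[OF assms(1,2)] pick_in_set_le[OF assms(3)] by auto

lemma ex_pick:
  assumes "finite P" "i \<in> P"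
  obtains a where "a < card P" "pick P a = i"
proof (rule that)
  show "pick P (card {a \<in> P. a < i}) = i" using assms by (simp add: pick_card_in_set)
  show "card {a \<in> P. a < i} < card P" using assms by (intro psubset_card_mono) auto
qed

lemma notin_active_modes:
  assumes "patch_partition N Ps" "P \<in> set Ps" "B \<in> carrier_mat N K" "k < K"
  shows "k \<notin> active_modes B P \<longleftrightarrow> (\<forall>a<card P. B $$ (pick P a, k) = 0)"
  using assms pick_less[OF assms(1,2)]
  unfolding active_modes_def restrict_vec_def by (auto simp: vec_eq_iff)

lemma patch_support_eq_iff:
  assumes "B \<in> carrier_mat N K" "C \<in> carrier_mat N K'" "k < K" "j < K'"
  shows "patch_support Ps (col B k) = patch_support Ps (col C j) \<longleftrightarrow>
    (\<forall>P\<in>set Ps. k \<in> active_modes B P \<longleftrightarrow> j \<in> active_modes C P)"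
  using assms unfolding patch_support_def active_modes_def by auto

text \<open>Double counting of the pairs of a mode and a patch on which it is active. Minimality can
  then be examined one patch at a time.\<close>

lemma sum_sparseness:
  assumes "distinct Ps"
  shows "(\<Sum>k<dim_col B. sparseness Ps (col B k)) = (\<Sum>P\<in>set Ps. card (active_modes B P))"
proof -
  have "(\<Sum>k<dim_col B. sparseness Ps (col B k)) =
    (\<Sum>k<dim_col B. \<Sum>P\<in>set Ps. of_bool (restrict_vec (col B k) P \<noteq> 0\<^sub>v (card P)))"
    unfolding sparseness_def patch_support_def by (simp add: of_bool_def sum.If_cases Int_def)
  also have "\<dots> = (\<Sum>P\<in>set Ps. \<Sum>k<dim_col B. of_bool (restrict_vec (col B k) P \<noteq> 0\<^sub>v (card P)))"
    by (rule sum.swap)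
  also have "\<dots> = (\<Sum>P\<in>set Ps. card (active_modes B P))"
    unfolding active_modes_def by (simp add: of_bool_def sum.If_cases Int_def)
  finally show ?thesis .
qed

text \<open>In the library a linear combination has coefficients attached to vectors, here they are
  attached to modes. Distinctness of the restricted active modes makes the translation
  possible.\<close>

lemma regular_sparse_imp_regular_modes:
  assumes part: "patch_partition N Ps" and g: "g \<in> carrier_mat N K"
    and li: "\<forall>P \<in> set Ps. lin_indpt_family (card P)
        (filter (\<lambda>v. v \<noteq> 0\<^sub>v (card P)) (map (\<lambda>\<psi>. restrict_vec \<psi> P) (cols g)))"
  shows "regular_modes Ps g"
  unfolding regular_modes_def
proof (intro ballI allI impI)
  fix P c k assume P: "P \<in> set Ps" and c: "\<forall>a<card P. (\<Sum>k<dim_col g. g $$ (pick P a, k) * c k) = 0"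
    and k: "k \<in> active_modes g P"
  define n where "n = card P"
  define f where "f k = restrict_vec (col g k) P" for k
  define S where "S = active_modes g P"
  define ks where "ks = filter (\<lambda>k. f k \<noteq> 0\<^sub>v n) [0..<K]"
  have S: "S = set ks" unfolding S_def ks_def active_modes_def f_def n_def using g by auto
  have "filter (\<lambda>v. v \<noteq> 0\<^sub>v (card P)) (map (\<lambda>\<psi>. restrict_vec \<psi> P) (cols g)) = map f ks"
    using g unfolding ks_def f_def n_def cols_def by (simp add: filter_map o_def)
  hence li': "lin_indpt_family n (map f ks)" using bspec[OF li P] unfolding n_def by (simp only:)
  interpret vec_space "TYPE(real)" n .
  have inj: "inj_on f S" and fS: "f ` S \<subseteq> carrier_vec n" and li: "\<not> lin_dep (f ` S)"
    using li' unfolding lin_indpt_family_def S by (auto simp: distinct_map)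
  \<comment> \<open>The vector \<open>f k\<close> receives the coefficient of its only mode
    \<open>k\<close> in \<open>S\<close>.\<close>
  let ?a = "\<lambda>w. c (the_inv_into S f w)"
  have "lincomb ?a (f ` S) = 0\<^sub>v n"
  proof (rule eq_vecI)
    fix i assume "i < dim_vec (0\<^sub>v n :: real vec)"
    hence i: "i < n" by simp
    have "lincomb ?a (f ` S) $ i = (\<Sum>x\<in>f ` S. ?a x * x $ i)" using lincomb_index[OF i fS] .
    also have "\<dots> = (\<Sum>k\<in>S. c k * f k $ i)"
      by (subst sum.reindex[OF inj]) (auto simp: the_inv_into_f_f[OF inj])
    also have "\<dots> = (\<Sum>k\<in>S. g $$ (pick P i, k) * c k)"
      using i g pick_less[OF part P] unfolding S_def active_modes_def f_def restrict_vec_def n_def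
      by (intro sum.cong) auto
    also have "\<dots> = (\<Sum>k<K. g $$ (pick P i, k) * c k)"
      using i g notin_active_modes[OF part P g] unfolding S_def n_def
      by (intro sum.mono_neutral_left active_modes_subset) auto
    finally show "lincomb ?a (f ` S) $ i = 0\<^sub>v n $ i" using c i g n_def by simp
  qed (use fS in \<open>simp add: lincomb_dim S\<close>)
  from not_lindepD[OF li _ subset_refl _ this] have "?a \<in> f ` S \<rightarrow> {0}"
    by (simp add: S class_ring_simps)
  hence "?a (f k) = 0" using k S_def by blast
  thus "c k = 0" using the_inv_into_f_f[OF inj] k S_def by simp
qed

section \<open>Minimal length of a decomposition and active patches\<close>

lemma rank_sum_products_le:
  fixes f :: "nat \<Rightarrow> nat \<Rightarrow> real"
  assumes "finite S"
  shows "vec_space.rank N (mat N N (\<lambda>(i, j). \<Sum>k\<in>S. f i k * f j k)) \<le> card S"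
  using assms
proof (induction S rule: finite_induct)
  case empty
  have "mat N N (\<lambda>(i, j). \<Sum>k\<in>{}. f i k * f j k) = 0\<^sub>m N N" by auto
  thus ?case by (simp only: vec_space.rank_0I)
next
  case (insert x S)
  let ?B = "mat N N (\<lambda>(i, j). f i x * f j x)"
  let ?C = "mat N N (\<lambda>(i, j). \<Sum>k\<in>S. f i k * f j k)"
  have "mat N N (\<lambda>(i, j). \<Sum>k\<in>insert x S. f i k * f j k) = ?B + ?C"
    using insert by auto
  moreover have "vec_space.rank N ?B \<le> 1"
    by (rule vec_space.rank_le_1_product_entries[of _ N N "\<lambda>i. f i x" "\<lambda>i. f i x"]) auto
  moreover have "vec_space.rank N (?B + ?C) \<le> vec_space.rank N ?B + vec_space.rank N ?C"
    by (rule vec_space.rank_subadditive) auto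
  ultimately show ?case using insert by simp
qed

text \<open>A zero mode could be dropped, leaving \<open>A\<close> as a sum of \<open>K - 1\<close>
  rank-one matrices and contradicting rank \<open>K\<close>.\<close>

lemma mode_decomposition_col_nonzero:
  assumes A: "A \<in> carrier_mat N N" and g: "mode_decomposition A g" and k: "k < dim_col g"
  shows "\<exists>i<N. g $$ (i, k) \<noteq> 0"
proof (rule ccontr)
  assume z: "\<not> ?thesis"
  define K where "K = vec_space.rank N A"
  have gc: "g \<in> carrier_mat N K" and Ag: "A = g * transpose_mat g"
    using A g unfolding mode_decomposition_def K_def by auto
  have kK: "k < K" using k gc by auto
  have "A = mat N N (\<lambda>(i, j). \<Sum>k\<in>{..<K} - {k}. g $$ (i, k) * g $$ (j, k))"
  proof (rule eq_matI)
    fix i j assume "i < dim_row (mat N N (\<lambda>(i, j). \<Sum>k\<in>{..<K} - {k}. g $$ (i, k) * g $$ (j, k)))"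
      "j < dim_col (mat N N (\<lambda>(i, j). \<Sum>k\<in>{..<K} - {k}. g $$ (i, k) * g $$ (j, k)))"
    hence ij: "i < N" "j < N" by auto
    have "A $$ (i, j) = (\<Sum>k<K. g $$ (i, k) * g $$ (j, k))"
      unfolding Ag using gc ij by (subst index_mult_mat_sum[of _ N K _ N]) auto
    also have "\<dots> = (\<Sum>k\<in>{..<K} - {k}. g $$ (i, k) * g $$ (j, k))"
      using z ij kK by (intro sum.mono_neutral_right) auto
    finally show "A $$ (i, j) = mat N N (\<lambda>(i, j). \<Sum>k\<in>{..<K} - {k}. g $$ (i, k) * g $$ (j, k)) $$ (i, j)"
      using ij by simp
  qed (use A in auto)
  hence "K \<le> card ({..<K} - {k})"
    using rank_sum_products_le[of "{..<K} - {k}" N "\<lambda>i k. g $$ (i, k)"] unfolding K_def by simp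
  thus False using kK by simp
qed

lemma ex_active_patch:
  assumes A: "A \<in> carrier_mat N N" and part: "patch_partition N Ps"
    and g: "mode_decomposition A g" and k: "k < dim_col g"
  shows "\<exists>P\<in>set Ps. k \<in> active_modes g P"
proof -
  have gc: "g \<in> carrier_mat N (dim_col g)" using A g unfolding mode_decomposition_def by auto
  obtain i where i: "i < N" "g $$ (i, k) \<noteq> 0" using mode_decomposition_col_nonzero[OF A g k] by auto
  have "i \<in> \<Union>(set Ps)" using i patch_partitionD(5)[OF part] by simp
  then obtain P where P: "P \<in> set Ps" "i \<in> P" by blast
  then obtain a where "a < card P" "pick P a = i"
    using ex_pick[of P i] patch_partitionD(4)[OF part] by blast
  thus ?thesis using notin_active_modes[OF part P(1) gc k] i P by metis
qed

text \<open>The columns of \<open>g\<close> are independent: in a relation \<open>g v = 0\<close>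
  the coefficient of mode \<open>k\<close> vanishes by regularity on a patch where \<open>k\<close>
  is active. The left inverse \<open>Z\<close> obtained from this turns equality of the Gram
  matrices into \<open>h = g (Z h)\<close>.\<close>

lemma regular_modes_rotation:
  assumes A: "A \<in> carrier_mat N N" and part: "patch_partition N Ps"
    and g: "mode_decomposition A g" and reg: "regular_modes Ps g" and h: "mode_decomposition A h"
    and K: "K = dim_col g"
  obtains U where "orthogonal_matrix K U" "h = g * U"
proof -
  have gc: "g \<in> carrier_mat N K" "h \<in> carrier_mat N K"
    using A g h unfolding mode_decomposition_def K by (metis carrier_matD)+
  have gram: "g * transpose_mat g = h * transpose_mat h"
    using g h unfolding mode_decomposition_def by metis
  obtain Z where Z: "Z \<in> carrier_mat K N" "Z * g = 1\<^sub>m K"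
  proof (rule left_inverse_exists[OF gc(1)])
    fix v assume v: "v \<in> carrier_vec K" and gv: "g *\<^sub>v v = 0\<^sub>v N"
    show "v = 0\<^sub>v K"
    proof (rule eq_vecI)
      fix k assume "k < dim_vec (0\<^sub>v K :: real vec)"
      hence k: "k < K" by simp
      obtain P where P: "P \<in> set Ps" "k \<in> active_modes g P" using ex_active_patch[OF A part g] k K by auto
      have "(\<Sum>k<dim_col g. g $$ (pick P a, k) * v $ k) = 0" if "a < card P" for a
      proof -
        have p: "pick P a < N" using pick_less[OF part P(1) that] .
        hence "(g *\<^sub>v v) $ pick P a = (\<Sum>k<K. g $$ (pick P a, k) * v $ k)"
          using gc v by (auto simp: scalar_prod_def lessThan_atLeast0 intro!: sum.cong)
        thus ?thesis using gv p K by simp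
      qed
      thus "v $ k = 0\<^sub>v K $ k" using reg P k unfolding regular_modes_def by auto
    qed (use v in auto)
  qed
  note U = gram_eq_left_inverse[OF gc Z gram]
  \<comment> \<open>The Gram argument gives orthonormal rows of \<open>Z * h\<close>, while
    \<open>orthogonal_matrix\<close> asks for orthonormal columns; hence the detour through the
    transpose.\<close>
  have "orthogonal_matrix K (transpose_mat (Z * h))"
    using U(2) Z gc unfolding orthogonal_matrix_def by auto
  hence "orthogonal_matrix K (Z * h)" using orthogonal_matrix_transpose by fastforce
  thus ?thesis using that U(1) by metis
qed

text \<open>Column \<open>j\<close> of \<open>U\<close> holds the coefficients of mode
  \<open>j\<close> of \<open>g * U\<close> in terms of \<open>g\<close>. If that mode vanishes on
  \<open>P\<close>, the column is a linear relation on \<open>P\<close>, to which regularity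
  applies.\<close>

lemma rotation_zero_entry:
  assumes part: "patch_partition N Ps" and P: "P \<in> set Ps" and g: "g \<in> carrier_mat N K"
    and reg: "regular_modes Ps g" and U: "U \<in> carrier_mat K K"
    and k: "k \<in> active_modes g P" and j: "j < K" "j \<notin> active_modes (g * U) P"
  shows "U $$ (k, j) = 0"
proof -
  have gU: "g * U \<in> carrier_mat N K" using g U by auto
  have "(\<Sum>k<dim_col g. g $$ (pick P a, k) * U $$ (k, j)) = 0" if "a < card P" for a
    using notin_active_modes[OF part P gU j(1)] j that pick_less[OF part P that] g U
    by (auto simp: index_mult_mat_sum[of g N K U K] simp del: index_mult_mat)
  from regular_modesD[where c = "\<lambda>k. U $$ (k, j)", OF reg P this k] show ?thesis by simp
qed

text \<open>The zero block of \<open>U\<close> has as rows the active modes of \<open>g\<close> and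
  as columns the inactive modes of \<open>g * U\<close>. Equal cardinalities also clear the opposite
  block, so a nonzero entry joins two active or two inactive modes.\<close>

lemma card_active_modes_le:
  assumes part: "patch_partition N Ps" and P: "P \<in> set Ps" and g: "g \<in> carrier_mat N K"
    and reg: "regular_modes Ps g" and U: "orthogonal_matrix K U"
  shows "card (active_modes g P) \<le> card (active_modes (g * U) P)"
    "card (active_modes g P) = card (active_modes (g * U) P) \<Longrightarrow> k < K \<Longrightarrow> j < K \<Longrightarrow> U $$ (k, j) \<noteq> 0 \<Longrightarrow>
      k \<in> active_modes g P \<longleftrightarrow> j \<in> active_modes (g * U) P"
proof -
  have Uc: "U \<in> carrier_mat K K" using U unfolding orthogonal_matrix_def by auto
  have gU: "g * U \<in> carrier_mat N K" using g Uc by auto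
  note z = rotation_zero_entry[OF part P g reg Uc]
  note b = orthogonal_matrix_zero_block[OF U active_modes_subset[OF g] active_modes_subset[OF gU], of P P, OF z]
  show "card (active_modes g P) \<le> card (active_modes (g * U) P)" by (rule b(1))
  assume "card (active_modes g P) = card (active_modes (g * U) P)" "k < K" "j < K" "U $$ (k, j) \<noteq> 0"
  thus "k \<in> active_modes g P \<longleftrightarrow> j \<in> active_modes (g * U) P" using z b(2) by blast
qed

text \<open>Every decomposition is a rotation of \<open>g\<close>, so \<open>g\<close> bounds all of
  them from below on each patch. A competitor that does not exceed \<open>g\<close> on any patch is
  therefore a minimizer.\<close>

lemma intrinsic_sparse_modesI:
  assumes A: "A \<in> carrier_mat N N" and part: "patch_partition N Ps"
    and g: "mode_decomposition A g" and reg: "regular_modes Ps g" and h: "mode_decomposition A h"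
    and le: "\<And>P. P \<in> set Ps \<Longrightarrow> card (active_modes h P) \<le> card (active_modes g P)"
  shows "intrinsic_sparse_modes A Ps h"
  unfolding intrinsic_sparse_modes_def is_arg_min_linorder
proof (intro conjI allI impI)
  fix y assume y: "mode_decomposition A y"
  define K where "K = dim_col g"
  have gc: "g \<in> carrier_mat N K" using A g unfolding K_def mode_decomposition_def by auto
  obtain U where U: "orthogonal_matrix K U" "y = g * U"
    using regular_modes_rotation[OF A part g reg y K_def] by blast
  show "(\<Sum>k<dim_col h. sparseness Ps (col h k)) \<le> (\<Sum>k<dim_col y. sparseness Ps (col y k))"
    unfolding sum_sparseness[OF patch_partitionD(1)[OF part]]
    using le card_active_modes_le(1)[OF part _ gc reg U(1)] unfolding U(2)
    by (intro sum_mono) (meson order_trans)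
qed (rule h)

lemma intrinsic_sparse_modes_rotation_regular:
  assumes A: "A \<in> carrier_mat N N" and part: "patch_partition N Ps"
    and g: "mode_decomposition A g" and reg: "regular_modes Ps g" and h: "intrinsic_sparse_modes A Ps h"
    and K: "K = dim_col g"
  obtains U where "orthogonal_matrix K U" "h = g * U"
    "\<And>k j. k < K \<Longrightarrow> j < K \<Longrightarrow> U $$ (k, j) \<noteq> 0 \<Longrightarrow> patch_support Ps (col g k) = patch_support Ps (col h j)"
proof -
  have hd: "mode_decomposition A h" and
    min: "(\<Sum>k<dim_col h. sparseness Ps (col h k)) \<le> (\<Sum>k<dim_col g. sparseness Ps (col g k))"
    using h g unfolding intrinsic_sparse_modes_def is_arg_min_linorder by auto
  have gc: "g \<in> carrier_mat N K" "h \<in> carrier_mat N K"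
    using A g hd unfolding K mode_decomposition_def by (metis carrier_matD)+
  obtain U where U: "orthogonal_matrix K U" "h = g * U"
    using regular_modes_rotation[OF A part g reg hd K] by blast
  have le: "card (active_modes g P) \<le> card (active_modes h P)" if "P \<in> set Ps" for P
    using card_active_modes_le(1)[OF part that gc(1) reg U(1)] U(2) by simp
  \<comment> \<open>One inequality is minimality of \<open>h\<close>, the other is the patchwise
    bound. Equal sums of termwise ordered counts force equality on every patch.\<close>
  have "(\<Sum>P\<in>set Ps. card (active_modes g P)) = (\<Sum>P\<in>set Ps. card (active_modes h P))"
    using min unfolding sum_sparseness[OF patch_partitionD(1)[OF part]]
    by - (rule order.antisym, rule sum_mono, erule le, assumption)
  hence eq: "card (active_modes g P) = card (active_modes h P)" if "P \<in> set Ps" for P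
    using sum_mono_inv[of "\<lambda>P. card (active_modes g P)" "set Ps" "\<lambda>P. card (active_modes h P)" P] le that by auto
  show ?thesis
  proof (rule that[OF U])
    fix k j assume "k < K" "j < K" "U $$ (k, j) \<noteq> 0"
    thus "patch_support Ps (col g k) = patch_support Ps (col h j)"
      using card_active_modes_le(2)[OF part _ gc(1) reg U(1), folded U(2)] eq
      unfolding patch_support_eq_iff[OF gc \<open>k < K\<close> \<open>j < K\<close>] by blast
  qed
qed

text \<open>Neither family needs to be the regular one, so both are compared with a regular
  \<open>g\<close>: \<open>h = g U\<close> and \<open>h' = g V\<close> give
  \<open>h' = h (U^T V)\<close>. A nonzero entry of \<open>U^T V\<close> comes from some mode
  \<open>l\<close> of \<open>g\<close> that shares its support with both modes concerned.\<close>

lemma intrinsic_sparse_modes_rotation: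
  assumes A: "A \<in> carrier_mat N N" and part: "patch_partition N Ps"
    and reg: "regular_sparse A Ps"
    and h: "intrinsic_sparse_modes A Ps h" and h': "intrinsic_sparse_modes A Ps h'"
    and K: "K = vec_space.rank N A"
  obtains U where "orthogonal_matrix K U" "h' = h * U"
    "\<And>k j. k < K \<Longrightarrow> j < K \<Longrightarrow> U $$ (k, j) \<noteq> 0 \<Longrightarrow> patch_support Ps (col h k) = patch_support Ps (col h' j)"
proof -
  obtain g where g: "mode_decomposition A g" and li: "\<forall>P \<in> set Ps. lin_indpt_family (card P)
        (filter (\<lambda>v. v \<noteq> 0\<^sub>v (card P)) (map (\<lambda>\<psi>. restrict_vec \<psi> P) (cols g)))"
    using reg unfolding regular_sparse_def by blast
  have gc: "g \<in> carrier_mat N K" using A g K unfolding mode_decomposition_def by auto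
  have Kg: "K = dim_col g" using gc by auto
  note rm = regular_sparse_imp_regular_modes[OF part gc li]
  obtain U where U: "orthogonal_matrix K U" "h = g * U"
    "\<And>k j. k < K \<Longrightarrow> j < K \<Longrightarrow> U $$ (k, j) \<noteq> 0 \<Longrightarrow> patch_support Ps (col g k) = patch_support Ps (col h j)"
    using intrinsic_sparse_modes_rotation_regular[OF A part g rm h Kg] by metis
  obtain V where V: "orthogonal_matrix K V" "h' = g * V"
    "\<And>k j. k < K \<Longrightarrow> j < K \<Longrightarrow> V $$ (k, j) \<noteq> 0 \<Longrightarrow> patch_support Ps (col g k) = patch_support Ps (col h' j)"
    using intrinsic_sparse_modes_rotation_regular[OF A part g rm h' Kg] by metis
  have c: "U \<in> carrier_mat K K" "V \<in> carrier_mat K K" "transpose_mat U \<in> carrier_mat K K"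
    using U V unfolding orthogonal_matrix_def by auto
  show ?thesis
  proof (rule that)
    show "orthogonal_matrix K (transpose_mat U * V)"
      using U V orthogonal_matrix_mult orthogonal_matrix_transpose by blast
    have "h * (transpose_mat U * V) = g * (U * transpose_mat U * V)"
      unfolding U(2) assoc_mult_mat[OF gc c(1) mult_carrier_mat[OF c(3,2)]] assoc_mult_mat[OF c(1) c(3) c(2)] ..
    thus "h' = h * (transpose_mat U * V)" using V c gc by (simp add: orthogonal_matrix_right[OF U(1)])
    fix k j assume kj: "k < K" "j < K" and nz: "(transpose_mat U * V) $$ (k, j) \<noteq> 0"
    have "(\<Sum>l<K. U $$ (l, k) * V $$ (l, j)) \<noteq> 0"
      using nz c kj by (auto simp: index_mult_mat_sum[of _ K K _ K] simp del: index_mult_mat)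
    then obtain l where "l < K" "U $$ (l, k) * V $$ (l, j) \<noteq> 0"
      by (meson lessThan_iff sum.neutral)
    thus "patch_support Ps (col h k) = patch_support Ps (col h' j)"
      using U(3)[of l k] V(3)[of l j] kj by auto
  qed
qed

section \<open>Block matrices\<close>

lemma block_indices_Cons:
  "block_indices (k # ks) = map (Pair 0) [0..<k] @ map (\<lambda>(m, a). (Suc m, a)) (block_indices ks)"
proof -
  have "[0..<length (k # ks)] = 0 # map Suc [0..<length ks]"
    by (simp add: map_Suc_upt upt_conv_Cons del: upt_Suc)
  thus ?thesis unfolding block_indices_def by (simp add: map_concat o_def)
qed

lemma block_indices_Nil [simp]: "block_indices [] = []"
  unfolding block_indices_def by simp

lemma length_block_indices [simp]: "length (block_indices ks) = sum_list ks"
  by (induction ks) (auto simp: block_indices_Cons)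

lemma set_block_indices: "set (block_indices ks) = (SIGMA m:{..<length ks}. {..<ks ! m})"
  unfolding block_indices_def by auto

lemma distinct_block_indices: "distinct (block_indices ks)"
  by (induction ks) (auto simp: block_indices_Cons distinct_map inj_on_def)

lemma block_indices_nth:
  assumes "i < sum_list ks" "block_indices ks ! i = (m, a)"
  shows "m < length ks" "a < ks ! m"
  using assms nth_mem[of i "block_indices ks"] by (auto simp: set_block_indices)

lemma ex_block_index:
  assumes "m < length ks" "a < ks ! m"
  obtains i where "i < sum_list ks" "block_indices ks ! i = (m, a)"
proof -
  have "(m, a) \<in> set (block_indices ks)" using assms by (auto simp: set_block_indices)
  thus ?thesis using that by (auto simp: in_set_conv_nth)
qed

lemma block_indices_inj:
  assumes "i < sum_list ks" "j < sum_list ks" "block_indices ks ! i = block_indices ks ! j"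
  shows "i = j"
  using assms distinct_block_indices by (simp add: nth_eq_iff_index_eq)

lemma sum_block_indices:
  "(\<Sum>i<sum_list ks. f (block_indices ks ! i)) = (\<Sum>m<length ks. \<Sum>a<ks ! m. f (m, a))"
proof -
  have "(\<Sum>i<sum_list ks. f (block_indices ks ! i)) = sum f (set (block_indices ks))"
    by (rule sum.reindex_bij_betw, rule bij_betw_nth) (auto simp: distinct_block_indices)
  thus ?thesis unfolding set_block_indices by (simp add: sum.Sigma)
qed

text \<open>Bridge between the recursive four-block form of \<open>diag_block_mat\<close> and the
  pairs (block, index in block). Induction peels off the first block: indices beyond it shift by its
  size, block numbers by one.\<close>

lemma diag_block_mat_index:
  assumes "i < sum_list (map dim_row Bs)" "block_indices (map dim_row Bs) ! i = (m, a)"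
    "j < sum_list (map dim_col Bs)" "block_indices (map dim_col Bs) ! j = (n, b)"
  shows "diag_block_mat Bs $$ (i, j) = (if m = n then (Bs ! m) $$ (a, b) else 0)"
  using assms
proof (induction Bs arbitrary: i j m n a b)
  case Nil
  thus ?case by simp
next
  case (Cons B Bs)
  let ?r = "dim_row B" and ?c = "dim_col B" and ?D = "diag_block_mat Bs"
  have D: "dim_row ?D = sum_list (map dim_row Bs)" "dim_col ?D = sum_list (map dim_col Bs)"
    by (simp_all add: dim_diag_block_mat)
  have eq: "diag_block_mat (B # Bs) $$ (i, j) =
    (if i < ?r then if j < ?c then B $$ (i, j) else 0
     else if j < ?c then 0 else ?D $$ (i - ?r, j - ?c))"
    using Cons.prems D by (auto simp: Let_def)
  have row: "if i < ?r then m = 0 \<and> a = i else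
      m \<noteq> 0 \<and> i - ?r < sum_list (map dim_row Bs) \<and> block_indices (map dim_row Bs) ! (i - ?r) = (m - 1, a)"
    using Cons.prems(1,2) by (auto simp: block_indices_Cons nth_append split: prod.splits)
  have col: "if j < ?c then n = 0 \<and> b = j else
      n \<noteq> 0 \<and> j - ?c < sum_list (map dim_col Bs) \<and> block_indices (map dim_col Bs) ! (j - ?c) = (n - 1, b)"
    using Cons.prems(3,4) by (auto simp: block_indices_Cons nth_append split: prod.splits)
  show ?case
    using row col Cons.IH[of "i - ?r" "m - 1" a "j - ?c" "n - 1" b]
    unfolding eq by (cases m; cases n) (auto split: if_splits)
qed

lemma diag_block_mat_transpose:
  "transpose_mat (diag_block_mat Bs) = diag_block_mat (map transpose_mat Bs)"
proof (rule eq_matI)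
  fix i j assume "i < dim_row (diag_block_mat (map transpose_mat Bs))" "j < dim_col (diag_block_mat (map transpose_mat Bs))"
  hence ij: "i < sum_list (map dim_col Bs)" "j < sum_list (map dim_row Bs)"
    by (auto simp: dim_diag_block_mat o_def)
  obtain m a n b where idx: "block_indices (map dim_col Bs) ! i = (m, a)" "block_indices (map dim_row Bs) ! j = (n, b)"
    by fastforce
  note r = block_indices_nth[OF ij(1) idx(1)] block_indices_nth[OF ij(2) idx(2)]
  have "diag_block_mat (map transpose_mat Bs) $$ (i, j) = (if m = n then (map transpose_mat Bs ! m) $$ (a, b) else 0)"
    by (rule diag_block_mat_index) (use ij idx in \<open>auto simp: o_def\<close>)
  moreover have "diag_block_mat Bs $$ (j, i) = (if n = m then (Bs ! n) $$ (b, a) else 0)"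
    by (rule diag_block_mat_index) (use ij idx in auto)
  ultimately show "transpose_mat (diag_block_mat Bs) $$ (i, j) = diag_block_mat (map transpose_mat Bs) $$ (i, j)"
    using ij r by (auto simp: dim_diag_block_mat)
qed (auto simp: dim_diag_block_mat o_def)

section \<open>Vertical stacks of blocks with \<open>K\<close> common columns\<close>

definition block_rows :: "nat list \<Rightarrow> nat \<Rightarrow> (nat \<Rightarrow> real mat) \<Rightarrow> real mat" where
  "block_rows ks K F = mat (sum_list ks) K (\<lambda>(i, k). let (m, a) = block_indices ks ! i in F m $$ (a, k))"

lemma block_rows_carrier [simp]: "block_rows ks K F \<in> carrier_mat (sum_list ks) K"
  unfolding block_rows_def by simp

lemma block_rows_index:
  assumes "i < sum_list ks" "block_indices ks ! i = (m, a)" "k < K"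
  shows "block_rows ks K F $$ (i, k) = F m $$ (a, k)"
  using assms unfolding block_rows_def by simp

lemma block_rows_cong:
  assumes "\<And>m. m < length ks \<Longrightarrow> F m = G m"
  shows "block_rows ks K F = block_rows ks K G"
  unfolding block_rows_def using assms block_indices_nth[of _ ks]
  by (intro cong_mat) (auto split: prod.splits)

text \<open>Sizes and block products are passed as \<open>rs\<close>, \<open>cs\<close> and
  \<open>G\<close>, so that the rule directly yields the global identities \<open>D W = L\<close>,
  \<open>D^T L = W\<close> and \<open>H_ext L = g\<close> from those on each patch.\<close>

lemma diag_block_mat_mult_block_rows:
  assumes rs: "map dim_row Bs = rs" and cs: "map dim_col Bs = cs"
    and F': "\<And>m. m < length Bs \<Longrightarrow> F m \<in> carrier_mat (cs ! m) K"
    and G: "\<And>m. m < length Bs \<Longrightarrow> Bs ! m * F m = G m"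
  shows "diag_block_mat Bs * block_rows cs K F = block_rows rs K G"
proof -
  let ?r = "map dim_row Bs" and ?c = "map dim_col Bs" and ?D = "diag_block_mat Bs"
  have F: "F m \<in> carrier_mat (dim_col (Bs ! m)) K" if "m < length Bs" for m
    using F'[OF that] that cs by auto
  have "?D * block_rows ?c K F = block_rows ?r K (\<lambda>m. Bs ! m * F m)"
  proof (rule eq_matI)
    have D: "?D \<in> carrier_mat (sum_list ?r) (sum_list ?c)"
      by (intro carrier_matI) (simp_all add: dim_diag_block_mat)
    fix i k assume "i < dim_row (block_rows ?r K (\<lambda>m. Bs ! m * F m))" "k < dim_col (block_rows ?r K (\<lambda>m. Bs ! m * F m))"
    hence i: "i < sum_list ?r" and k: "k < K" unfolding block_rows_def by auto
    obtain m a where idx: "block_indices ?r ! i = (m, a)" by fastforce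
    have m: "m < length Bs" and a: "a < dim_row (Bs ! m)" using block_indices_nth[OF i idx] by auto
    have "(?D * block_rows ?c K F) $$ (i, k) = (\<Sum>j<sum_list ?c. ?D $$ (i, j) * block_rows ?c K F $$ (j, k))"
      by (rule index_mult_mat_sum[OF D _ i k]) simp
    also have "\<dots> = (\<Sum>j<sum_list ?c. (\<lambda>(n, b). (if m = n then (Bs ! m) $$ (a, b) else 0) * F n $$ (b, k)) (block_indices ?c ! j))"
      using diag_block_mat_index[OF i idx] k by (intro sum.cong) (auto simp: block_rows_def split: prod.splits)
    also have "\<dots> = (\<Sum>n<length Bs. \<Sum>b<?c ! n. (if m = n then (Bs ! m) $$ (a, b) else 0) * F n $$ (b, k))"
      unfolding sum_block_indices by simp
    also have "\<dots> = (\<Sum>n<length Bs. if m = n then \<Sum>b<dim_col (Bs ! m). (Bs ! m) $$ (a, b) * F m $$ (b, k) else 0)"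
      by (intro sum.cong) auto
    also have "\<dots> = (\<Sum>b<dim_col (Bs ! m). (Bs ! m) $$ (a, b) * F m $$ (b, k))" using m by simp
    also have "\<dots> = (Bs ! m * F m) $$ (a, k)"
      by (rule index_mult_mat_sum[symmetric, OF _ F[OF m] a k]) simp
    finally show "(?D * block_rows ?c K F) $$ (i, k) = block_rows ?r K (\<lambda>m. Bs ! m * F m) $$ (i, k)"
      using block_rows_index[OF i idx k] by simp
  qed (auto simp: dim_diag_block_mat block_rows_def)
  also have "\<dots> = block_rows ?r K G" using G by (intro block_rows_cong) auto
  finally show ?thesis unfolding rs cs .
qed

lemma block_rows_mult_right:
  assumes F: "\<And>m. m < length ks \<Longrightarrow> F m \<in> carrier_mat (ks ! m) K" and U: "U \<in> carrier_mat K K'"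
  shows "block_rows ks K F * U = block_rows ks K' (\<lambda>m. F m * U)"
proof (rule eq_matI)
  fix i j assume "i < dim_row (block_rows ks K' (\<lambda>m. F m * U))" "j < dim_col (block_rows ks K' (\<lambda>m. F m * U))"
  hence i: "i < sum_list ks" and j: "j < K'" unfolding block_rows_def by auto
  obtain m a where idx: "block_indices ks ! i = (m, a)" by fastforce
  note ma = block_indices_nth[OF i idx]
  show "(block_rows ks K F * U) $$ (i, j) = block_rows ks K' (\<lambda>m. F m * U) $$ (i, j)"
    unfolding block_rows_index[OF i idx j] index_mult_mat_sum[OF F[OF ma(1)] U ma(2) j]
      index_mult_mat_sum[OF block_rows_carrier U i j]
    using block_rows_index[OF i idx] by (intro sum.cong) auto
qed (use U in \<open>auto simp: block_rows_def\<close>)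

lemma block_rows_mult_transpose:
  assumes F: "\<And>m. m < length ks \<Longrightarrow> F m \<in> carrier_mat (ks ! m) K"
  shows "block_rows ks K F * transpose_mat (block_rows ks K F) = block_matrix ks (\<lambda>m n. F m * transpose_mat (F n))"
proof (rule eq_matI)
  let ?B = "block_matrix ks (\<lambda>m n. F m * transpose_mat (F n))"
  fix i j assume "i < dim_row ?B" "j < dim_col ?B"
  hence ij: "i < sum_list ks" "j < sum_list ks" unfolding block_matrix_def by auto
  obtain m a n b where idx: "block_indices ks ! i = (m, a)" "block_indices ks ! j = (n, b)" by fastforce
  note ma = block_indices_nth[OF ij(1) idx(1)] and nb = block_indices_nth[OF ij(2) idx(2)]
  have "(block_rows ks K F * transpose_mat (block_rows ks K F)) $$ (i, j) = (\<Sum>k<K. F m $$ (a, k) * F n $$ (b, k))"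
    using ij idx block_rows_index[OF ij(1) idx(1)] block_rows_index[OF ij(2) idx(2)]
    by (subst index_mult_mat_sum[of _ "sum_list ks" K _ "sum_list ks"]) (auto simp: block_rows_def)
  also have "\<dots> = (F m * transpose_mat (F n)) $$ (a, b)"
    using F[OF ma(1)] F[OF nb(1)] ma nb
    by (subst index_mult_mat_sum[of _ "ks ! m" K _ "ks ! n"]) auto
  finally show "(block_rows ks K F * transpose_mat (block_rows ks K F)) $$ (i, j) = ?B $$ (i, j)"
    unfolding block_matrix_def using ij idx by simp
qed (auto simp: block_matrix_def block_rows_def)

lemma transpose_mult_block_rows:
  assumes F: "\<And>m. m < length ks \<Longrightarrow> F m \<in> carrier_mat (ks ! m) K" and k: "k < K" and l: "l < K"
  shows "(transpose_mat (block_rows ks K F) * block_rows ks K F) $$ (k, l) =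
    (\<Sum>m<length ks. (transpose_mat (F m) * F m) $$ (k, l))"
proof -
  have "(transpose_mat (block_rows ks K F) * block_rows ks K F) $$ (k, l) =
    (\<Sum>i<sum_list ks. block_rows ks K F $$ (i, k) * block_rows ks K F $$ (i, l))"
    using k l by (subst index_mult_mat_sum[of _ K "sum_list ks" _ K]) (auto simp: block_rows_def)
  also have "\<dots> = (\<Sum>i<sum_list ks. (\<lambda>(m, a). F m $$ (a, k) * F m $$ (a, l)) (block_indices ks ! i))"
    using k l by (intro sum.cong) (auto simp: block_rows_def split: prod.splits)
  also have "\<dots> = (\<Sum>m<length ks. \<Sum>a<ks ! m. F m $$ (a, k) * F m $$ (a, l))"
    unfolding sum_block_indices by simp
  also have "\<dots> = (\<Sum>m<length ks. (transpose_mat (F m) * F m) $$ (k, l))"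
  proof (rule sum.cong)
    fix m assume "m \<in> {..<length ks}"
    hence "F m \<in> carrier_mat (ks ! m) K" using F by simp
    thus "(\<Sum>a<ks ! m. F m $$ (a, k) * F m $$ (a, l)) = (transpose_mat (F m) * F m) $$ (k, l)"
      using k l by (subst index_mult_mat_sum[of _ K "ks ! m" _ K]) auto
  qed simp
  finally show ?thesis .
qed

section \<open>Reordering rows by patches\<close>

lemma patch_order_eq:
  "patch_order Ps = map (\<lambda>(m, a). pick (Ps ! m) a) (block_indices (map card Ps))"
proof -
  have "map (\<lambda>P. map (pick P) [0..<card P]) Ps = map (\<lambda>m. map (pick (Ps ! m)) [0..<card (Ps ! m)]) [0..<length Ps]"
    by (rule nth_equalityI) auto
  thus ?thesis unfolding patch_order_def block_indices_def
    by (simp add: map_concat o_def) (rule arg_cong[where f = concat], auto)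
qed

lemma rows_by_patch_eq:
  assumes part: "patch_partition N Ps" and B: "B \<in> carrier_mat N K"
  shows "rows_by_patch Ps B = block_rows (map card Ps) K (\<lambda>m. patch_rows B (Ps ! m))"
proof (rule eq_matI)
  let ?R = "block_rows (map card Ps) K (\<lambda>m. patch_rows B (Ps ! m))"
  fix i k assume "i < dim_row ?R" "k < dim_col ?R"
  hence i: "i < sum_list (map card Ps)" and k: "k < K" unfolding block_rows_def by auto
  obtain m a where idx: "block_indices (map card Ps) ! i = (m, a)" by fastforce
  note ma = block_indices_nth[OF i idx]
  show "rows_by_patch Ps B $$ (i, k) = ?R $$ (i, k)"
    using i k ma B idx block_rows_index[OF i idx k]
    unfolding rows_by_patch_def patch_order_eq by (simp add: patch_rows_def)
qed (use B in \<open>auto simp: rows_by_patch_def block_rows_def patch_order_eq\<close>)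

lemma patch_rows_mult:
  assumes part: "patch_partition N Ps" and P: "P \<in> set Ps" and B: "B \<in> carrier_mat N K" and U: "U \<in> carrier_mat K K'"
  shows "patch_rows (B * U) P = patch_rows B P * U"
proof (rule eq_matI)
  fix a j assume "a < dim_row (patch_rows B P * U)" "j < dim_col (patch_rows B P * U)"
  hence a: "a < card P" and j: "j < K'" using U unfolding patch_rows_def by auto
  have "patch_rows (B * U) P $$ (a, j) = (B * U) $$ (pick P a, j)"
    using a j U B unfolding patch_rows_def by (simp del: index_mult_mat(1))
  also have "\<dots> = (\<Sum>k<K. B $$ (pick P a, k) * U $$ (k, j))"
    by (rule index_mult_mat_sum[OF B U pick_less[OF part P a] j])
  also have "\<dots> = (patch_rows B P * U) $$ (a, j)"
    using B U a j by (subst index_mult_mat_sum[of _ "card P" K _ K']) (auto simp: patch_rows_def)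
  finally show "patch_rows (B * U) P $$ (a, j) = (patch_rows B P * U) $$ (a, j)" .
qed (auto simp: patch_rows_def)

lemma rows_by_patch_mult:
  assumes part: "patch_partition N Ps" and B: "B \<in> carrier_mat N K" and U: "U \<in> carrier_mat K K'"
  shows "rows_by_patch Ps (B * U) = rows_by_patch Ps B * U"
proof -
  have "rows_by_patch Ps B * U = block_rows (map card Ps) K' (\<lambda>m. patch_rows B (Ps ! m) * U)"
    unfolding rows_by_patch_eq[OF part B]
    using B U by (intro block_rows_mult_right) auto
  also have "\<dots> = block_rows (map card Ps) K' (\<lambda>m. patch_rows (B * U) (Ps ! m))"
    using patch_rows_mult[OF part _ B U] by (intro block_rows_cong) auto
  finally show ?thesis using rows_by_patch_eq[OF part mult_carrier_mat[OF B U]] by simp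
qed

text \<open>The patches cover all rows, so the reordering loses nothing. This is what recovers
  \<open>G\<close> itself, as the procedure prescribes only its reordered rows.\<close>

lemma rows_by_patch_inj:
  assumes part: "patch_partition N Ps" and B: "B \<in> carrier_mat N K" "C \<in> carrier_mat N K"
    and eq: "rows_by_patch Ps B = rows_by_patch Ps C"
  shows "B = C"
proof (rule eq_matI)
  fix i k assume "i < dim_row C" "k < dim_col C"
  hence i: "i < N" and k: "k < K" using B by auto
  have "i \<in> \<Union>(set Ps)" using i patch_partitionD(5)[OF part] by simp
  then obtain m where m: "m < length Ps" "i \<in> Ps ! m" by (auto simp: in_set_conv_nth)
  then obtain a where a: "a < card (Ps ! m)" "pick (Ps ! m) a = i"
    using ex_pick[of "Ps ! m" i] patch_partitionD(4)[OF part nth_mem] by blast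
  obtain r where r: "r < sum_list (map card Ps)" "block_indices (map card Ps) ! r = (m, a)"
    using ex_block_index[of m "map card Ps" a] m a by auto
  have "rows_by_patch Ps D $$ (r, k) = D $$ (i, k)" if "D \<in> carrier_mat N K" for D
    unfolding rows_by_patch_eq[OF part that] block_rows_index[OF r k]
    using a k that by (simp add: patch_rows_def)
  from this[OF B(1)] this[OF B(2)] eq show "B $$ (i, k) = C $$ (i, k)" by simp
qed (use B in auto)

section \<open>Patch blocks and joint diagonalisation\<close>

lemma patch_block_gram:
  assumes part: "patch_partition N Ps" and g: "g \<in> carrier_mat N K" and A: "A = g * transpose_mat g"
    and mn: "m < length Ps" "n < length Ps"
  shows "patch_block A Ps m n = patch_rows g (Ps ! m) * transpose_mat (patch_rows g (Ps ! n))"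
proof -
  have Ac: "A \<in> carrier_mat N N" using A g by auto
  have c: "{i. i < N \<and> i \<in> Ps ! m} = Ps ! m" if "m < length Ps" for m
    using patch_partitionD(2)[OF part nth_mem[OF that]] by auto
  note X = patch_rows_carrier[OF g]
  note p = pick_less[OF part nth_mem]
  show ?thesis
  proof (rule eq_matI)
    fix a b assume "a < dim_row (patch_rows g (Ps ! m) * transpose_mat (patch_rows g (Ps ! n)))"
      "b < dim_col (patch_rows g (Ps ! m) * transpose_mat (patch_rows g (Ps ! n)))"
    hence ab: "a < card (Ps ! m)" "b < card (Ps ! n)" by (auto simp: patch_rows_def)
    note q = p[OF mn(1) ab(1)] p[OF mn(2) ab(2)]
    have "patch_block A Ps m n $$ (a, b) = A $$ (pick (Ps ! m) a, pick (Ps ! n) b)"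
      unfolding patch_block_def submatrix_def using Ac c mn ab by simp
    also have "\<dots> = (\<Sum>k<K. g $$ (pick (Ps ! m) a, k) * g $$ (pick (Ps ! n) b, k))"
      unfolding A using g q by (subst index_mult_mat_sum[of _ N K _ N]) auto
    also have "\<dots> = (patch_rows g (Ps ! m) * transpose_mat (patch_rows g (Ps ! n))) $$ (a, b)"
      using X[of "Ps ! m"] X[of "Ps ! n"] ab g by (subst index_mult_mat_sum[of _ "card (Ps ! m)" K _ "card (Ps ! n)"])
        (auto simp: patch_rows_def)
    finally show "patch_block A Ps m n $$ (a, b) = (patch_rows g (Ps ! m) * transpose_mat (patch_rows g (Ps ! n))) $$ (a, b)" .
  qed (use Ac c mn in \<open>auto simp: patch_block_def submatrix_def patch_rows_def\<close>)
qed

text \<open>Orthonormality of the eigenvectors makes \<open>H^T H\<close> the diagonal matrix of the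
  positive eigenvalues, whose inverse is the explicit matrix \<open>?I\<close>.\<close>

lemma eigen_factor_left_pinv:
  assumes "eigen_factor B H"
  shows "H \<in> carrier_mat (dim_row B) (dim_col H)" "B = H * transpose_mat H"
    "left_pinv H \<in> carrier_mat (dim_col H) (dim_row B)" "left_pinv H * H = 1\<^sub>m (dim_col H)"
proof -
  define n r where "n = dim_row B" and "r = vec_space.rank (dim_row B) B"
  obtain \<gamma> h where eig: "eigendecomposition B r \<gamma> h"
    and H_def: "H = mat_of_cols n (map (\<lambda>i. sqrt (\<gamma> i) \<cdot>\<^sub>v h i) [0..<r])"
    using assms unfolding eigen_factor_def Let_def r_def n_def by blast
  have pos: "\<And>i. i < r \<Longrightarrow> \<gamma> i > 0" and hc: "\<And>i. i < r \<Longrightarrow> h i \<in> carrier_vec n"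
    and orth: "\<And>i j. i < r \<Longrightarrow> j < r \<Longrightarrow> h i \<bullet> h j = (if i = j then 1 else 0)"
    and B: "B = mat n n (\<lambda>(a, b). \<Sum>i<r. \<gamma> i * (h i $ a) * (h i $ b))"
    using eig unfolding eigendecomposition_def n_def by blast+
  have H: "H \<in> carrier_mat n r" unfolding H_def by auto
  have Hi: "H $$ (a, i) = sqrt (\<gamma> i) * h i $ a" if "a < n" "i < r" for a i
    unfolding H_def using that hc[of i] by (simp add: mat_of_cols_index)
  have r: "dim_col H = r" using H by simp
  show "H \<in> carrier_mat (dim_row B) (dim_col H)" using H n_def by simp
  show "B = H * transpose_mat H"
  proof (rule eq_matI)
    fix a b assume "a < dim_row (H * transpose_mat H)" "b < dim_col (H * transpose_mat H)"
    hence ab: "a < n" "b < n" using H by auto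
    have "(H * transpose_mat H) $$ (a, b) = (\<Sum>i<r. H $$ (a, i) * H $$ (b, i))"
      using H ab by (subst index_mult_mat_sum[of _ n r _ n]) auto
    also have "\<dots> = (\<Sum>i<r. \<gamma> i * (h i $ a) * (h i $ b))"
    proof (rule sum.cong)
      fix i assume "i \<in> {..<r}"
      hence i: "i < r" by simp
      have "sqrt (\<gamma> i) * sqrt (\<gamma> i) = \<gamma> i" using pos[OF i] by simp
      thus "H $$ (a, i) * H $$ (b, i) = \<gamma> i * (h i $ a) * (h i $ b)"
        unfolding Hi[OF ab(1) i] Hi[OF ab(2) i] by (metis mult.assoc mult.commute)
    qed simp
    finally show "B $$ (a, b) = (H * transpose_mat H) $$ (a, b)" using ab by (subst B) simp
  qed (use H n_def arg_cong[OF B, of dim_col] in auto)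
  let ?M = "transpose_mat H * H"
  let ?I = "mat r r (\<lambda>(i, j). if i = j then 1 / \<gamma> i else 0)"
  have M: "?M \<in> carrier_mat r r" using H by auto
  have Mi: "?M $$ (i, j) = (if i = j then \<gamma> i else 0)" if "i < r" "j < r" for i j
  proof -
    have "?M $$ (i, j) = (\<Sum>a<n. H $$ (a, i) * H $$ (a, j))"
      using H that by (subst index_mult_mat_sum[of _ r n _ r]) auto
    also have "\<dots> = (\<Sum>a<n. sqrt (\<gamma> i) * sqrt (\<gamma> j) * (h i $ a * h j $ a))"
      using Hi that by (intro sum.cong) auto
    also have "\<dots> = sqrt (\<gamma> i) * sqrt (\<gamma> j) * (h i \<bullet> h j)"
      using hc[of j] that unfolding scalar_prod_def by (simp add: sum_distrib_left lessThan_atLeast0)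
    finally show ?thesis using orth[OF that] pos[OF that(1)] by (cases "i = j") simp_all
  qed
  have MI: "?M * ?I = 1\<^sub>m r"
  proof (rule eq_matI)
    fix i j assume "i < dim_row (1\<^sub>m r :: real mat)" "j < dim_col (1\<^sub>m r :: real mat)"
    hence ij: "i < r" "j < r" by auto
    have "(?M * ?I) $$ (i, j) = (\<Sum>k<r. ?M $$ (i, k) * ?I $$ (k, j))"
      by (rule index_mult_mat_sum[OF M _ ij]) auto
    also have "\<dots> = (\<Sum>k<r. if i = k then (if k = j then 1 else 0) else 0)"
    proof (rule sum.cong)
      fix k assume "k \<in> {..<r}"
      hence k: "k < r" by simp
      have "\<gamma> k \<noteq> 0" using pos[OF k] by simp
      thus "?M $$ (i, k) * ?I $$ (k, j) = (if i = k then (if k = j then 1 else 0) else 0)"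
        unfolding Mi[OF ij(1) k] using k ij by auto
    qed simp
    finally show "(?M * ?I) $$ (i, j) = 1\<^sub>m r $$ (i, j)" using ij by simp
  qed (use H in auto)
  have Ic: "?I \<in> carrier_mat r r" by simp
  \<comment> \<open>\<open>left_pinv\<close> takes \<open>the\<close> of an option; being a unit
    excludes the value \<open>None\<close>.\<close>
  have "?M \<in> Units (ring_mat TYPE(real) r ())"
    using M Ic MI mat_mult_left_right_inverse[OF M Ic MI] unfolding Units_def ring_mat_def by auto
  then obtain C where C: "mat_inverse ?M = Some C" using mat_inverse(1)[OF M] by fastforce
  have CM: "C * ?M = 1\<^sub>m r" "C \<in> carrier_mat r r" using mat_inverse(2)[OF M C] by auto
  show "left_pinv H \<in> carrier_mat (dim_col H) (dim_row B)"
    unfolding left_pinv_def C r using CM H n_def by auto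
  have "left_pinv H * H = C * ?M"
    unfolding left_pinv_def C option.sel using CM(2) H by (intro assoc_mult_mat[of _ r r _ n _ r]) auto
  thus "left_pinv H * H = 1\<^sub>m (dim_col H)" using CM r by simp
qed

lemma assoc_mult_mat4:
  assumes "A \<in> carrier_mat a b" "B \<in> carrier_mat b c" "C \<in> carrier_mat c d" "D \<in> carrier_mat d e"
  shows "(A * B) * (C * D) = A * (B * C) * D"
proof -
  have "(A * B) * (C * D) = A * (B * (C * D))"
    using assms by (intro assoc_mult_mat[of _ a b _ c _ e]) auto
  also have "B * (C * D) = (B * C) * D"
    using assms by (intro assoc_mult_mat[symmetric, of _ b c _ d _ e]) auto
  also have "A * ((B * C) * D) = A * (B * C) * D"
    using assms by (intro assoc_mult_mat[symmetric, of _ a b _ d _ e]) auto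
  finally show ?thesis .
qed

section \<open>Diagonal indicator matrices and coordinates within a patch\<close>

definition diag_ind :: "nat \<Rightarrow> nat set \<Rightarrow> real mat" where
  "diag_ind K S = mat K K (\<lambda>(k, l). if k = l \<and> k \<in> S then 1 else 0)"

lemma diag_ind_carrier [simp]: "diag_ind K S \<in> carrier_mat K K"
  unfolding diag_ind_def by simp

lemma mult_diag_ind_index:
  assumes "B \<in> carrier_mat n K" "i < n" "k < K"
  shows "(B * diag_ind K S) $$ (i, k) = B $$ (i, k) * of_bool (k \<in> S)"
proof -
  have "(B * diag_ind K S) $$ (i, k) = (\<Sum>l<K. B $$ (i, l) * diag_ind K S $$ (l, k))"
    using assms by (intro index_mult_mat_sum) auto
  also have "\<dots> = (\<Sum>l<K. if l = k then B $$ (i, l) * of_bool (k \<in> S) else 0)"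
    using assms by (intro sum.cong) (auto simp: diag_ind_def)
  finally show ?thesis using assms by simp
qed

lemma diag_ind_commute: "diag_ind K S * diag_ind K T = diag_ind K T * diag_ind K S"
proof (rule eq_matI)
  fix i j assume "i < dim_row (diag_ind K T * diag_ind K S)" "j < dim_col (diag_ind K T * diag_ind K S)"
  hence ij: "i < K" "j < K" by (auto simp: diag_ind_def)
  show "(diag_ind K S * diag_ind K T) $$ (i, j) = (diag_ind K T * diag_ind K S) $$ (i, j)"
    unfolding mult_diag_ind_index[OF diag_ind_carrier ij] using ij by (simp add: diag_ind_def)
qed (auto simp: diag_ind_def)

text \<open>With \<open>X\<close> the rows of \<open>g\<close> on \<open>P\<close>,
  \<open>X = H L\<close> and \<open>L L^T = 1\<close> give \<open>X (L^T L) = X\<close>. Each column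
  of \<open>L^T L - 1\<close> is thus a linear relation among the modes on \<open>P\<close>, and
  regularity makes its entries at active modes zero. Columns of \<open>L\<close> at inactive modes
  vanish, which settles the other rows of \<open>L^T L\<close>.\<close>

lemma patch_coordinates:
  assumes part: "patch_partition N Ps" and P: "P \<in> set Ps" and g: "g \<in> carrier_mat N K"
    and reg: "regular_modes Ps g"
    and gram: "H * transpose_mat H = patch_rows g P * transpose_mat (patch_rows g P)"
    and H: "H \<in> carrier_mat (card P) r" and Z: "Z \<in> carrier_mat r (card P)" and ZH: "Z * H = 1\<^sub>m r"
  defines "L \<equiv> Z * patch_rows g P"
  shows "L \<in> carrier_mat r K" "H * L = patch_rows g P" "L * transpose_mat L = 1\<^sub>m r"
    "transpose_mat L * L = diag_ind K (active_modes g P)" "card (active_modes g P) = r"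
proof -
  let ?X = "patch_rows g P" and ?S = "active_modes g P"
  have X: "?X \<in> carrier_mat (card P) K" using g by simp
  show L: "L \<in> carrier_mat r K" unfolding L_def using Z X by auto
  show HL: "H * L = ?X" and LL: "L * transpose_mat L = 1\<^sub>m r"
    using gram_eq_left_inverse[OF H X Z ZH gram] unfolding L_def by auto
  let ?E = "transpose_mat L * L"
  have E: "?E \<in> carrier_mat K K" using L by auto
  have "?X * ?E = H * (L * (transpose_mat L * L))"
    unfolding HL[symmetric] using H L E by (intro assoc_mult_mat[of _ "card P" r _ K _ K]) auto
  also have "L * (transpose_mat L * L) = (L * transpose_mat L) * L"
    using L by (intro assoc_mult_mat[symmetric, of _ r K _ r _ K]) auto
  finally have XE: "?X * ?E = ?X" using LL L HL by simp
  have L0: "L $$ (i, k) = 0" if "i < r" "k < K" "k \<notin> ?S" for i k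
  proof -
    have "L $$ (i, k) = (\<Sum>a<card P. Z $$ (i, a) * ?X $$ (a, k))"
      unfolding L_def using that by (intro index_mult_mat_sum[OF Z X])
    also have "\<dots> = 0" using that notin_active_modes[OF part P g \<open>k < K\<close>] g
      by (intro sum.neutral) (auto simp: patch_rows_def)
    finally show ?thesis .
  qed
  have E_index: "?E $$ (k, l) = (\<Sum>i<r. L $$ (i, k) * L $$ (i, l))" if "k < K" "l < K" for k l
    using L that by (subst index_mult_mat_sum[of _ K r _ K]) auto
  show E_eq: "?E = diag_ind K ?S"
  proof (rule eq_matI)
    fix k l assume "k < dim_row (diag_ind K ?S)" "l < dim_col (diag_ind K ?S)"
    hence kl: "k < K" "l < K" by (auto simp: diag_ind_def)
    show "?E $$ (k, l) = diag_ind K ?S $$ (k, l)"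
    proof (cases "k \<in> ?S")
      case True
      have "?E $$ (k, l) - (if k = l then 1 else 0) = 0"
      \<comment> \<open>The relation is column \<open>l\<close> of \<open>L^T L - 1\<close>.\<close>
      proof (rule regular_modesD[where c = "\<lambda>k. ?E $$ (k, l) - (if k = l then 1 else 0)", OF reg P _ True])
        fix a assume a: "a < card P"
        have "(\<Sum>k<K. ?X $$ (a, k) * ?E $$ (k, l)) = ?X $$ (a, l)"
          using index_mult_mat_sum[OF X E a kl(2)] XE by simp
        moreover have "(\<Sum>k<K. ?X $$ (a, k) * (if k = l then 1 else 0)) = ?X $$ (a, l)"
          using kl by (simp add: if_distrib cong: if_cong)
        ultimately have "(\<Sum>k<K. ?X $$ (a, k) * (?E $$ (k, l) - (if k = l then 1 else 0))) = 0"
          by (simp only: right_diff_distrib sum_subtractf)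
        thus "(\<Sum>k<dim_col g. g $$ (pick P a, k) * (?E $$ (k, l) - (if k = l then 1 else 0))) = 0"
          using a g by (simp add: patch_rows_def del: index_mult_mat)
      qed
      thus ?thesis using True kl by (simp add: diag_ind_def del: index_mult_mat)
    next
      case False
      hence "?E $$ (k, l) = 0" unfolding E_index[OF kl] using L0 kl by (intro sum.neutral) auto
      thus ?thesis using False kl by (simp add: diag_ind_def del: index_mult_mat)
    qed
  qed (use L in \<open>auto simp: diag_ind_def\<close>)
  \<comment> \<open>The trace computed in two ways: \<open>L L^T\<close> gives \<open>r\<close>, and
    \<open>L^T L\<close> gives the number of active modes.\<close>
  have "(\<Sum>i<r. \<Sum>k<K. L $$ (i, k) * L $$ (i, k)) = (\<Sum>i<r. (L * transpose_mat L) $$ (i, i))"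
    using L by (intro sum.cong) (auto simp: index_mult_mat_sum[of _ r K _ r] simp del: index_mult_mat(1))
  hence "real r = (\<Sum>i<r. \<Sum>k<K. L $$ (i, k) * L $$ (i, k))" using LL by simp
  also have "\<dots> = (\<Sum>k<K. \<Sum>i<r. L $$ (i, k) * L $$ (i, k))" by (rule sum.swap)
  also have "\<dots> = (\<Sum>k<K. of_bool (k \<in> ?S))"
    by (intro sum.cong) (auto simp: E_index[symmetric] E_eq diag_ind_def simp del: index_mult_mat)
  also have "\<dots> = real (card ?S)" using active_modes_subset[OF g, of P]
    by (simp add: of_bool_def sum.If_cases Int_absorb1)
  finally show "card ?S = r" by simp
qed

lemma offdiag_sq_eq_0_iff:
  "offdiag_sq B = 0 \<longleftrightarrow> (\<forall>i<dim_row B. \<forall>j<dim_col B. i \<noteq> j \<longrightarrow> B $$ (i, j) = 0)"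
proof -
  have "finite {(i, j). i < dim_row B \<and> j < dim_col B \<and> i \<noteq> j}"
    by (rule finite_subset[of _ "{..<dim_row B} \<times> {..<dim_col B}"]) auto
  thus ?thesis unfolding offdiag_sq_def by (subst sum_nonneg_eq_0_iff) auto
qed

lemma offdiag_sq_nonneg: "offdiag_sq B \<ge> 0"
  unfolding offdiag_sq_def by (intro sum_nonneg) auto

text \<open>The columns of \<open>L\<close> belonging to \<open>S\<close> diagonalise all the matrices exactly, so every minimiser does.\<close>

lemma joint_diagonalizer_separates:
  assumes L: "L \<in> carrier_mat r K" and LL: "L * transpose_mat L = 1\<^sub>m r"
    and E: "transpose_mat L * L = diag_ind K S" and S: "S \<subseteq> {..<K}" "card S = r"
    and D: "joint_diagonalizer r M (\<lambda>n. L * diag_ind K (T n) * transpose_mat L) D"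
  defines "W \<equiv> transpose_mat D * L"
  shows "W \<in> carrier_mat r K" "transpose_mat W * W = diag_ind K S" "D * W = L"
    "n < M \<Longrightarrow> i < r \<Longrightarrow> \<exists>d. \<forall>k<K. W $$ (i, k) * of_bool (k \<in> T n) = d * W $$ (i, k)"
proof -
  let ?\<Sigma> = "\<lambda>n. L * diag_ind K (T n) * transpose_mat L"
  have orthD: "orthogonal_matrix r D" and
    min: "\<And>V. orthogonal_matrix r V \<Longrightarrow> (\<Sum>n<M. offdiag_sq (transpose_mat D * ?\<Sigma> n * D))
      \<le> (\<Sum>n<M. offdiag_sq (transpose_mat V * ?\<Sigma> n * V))"
    using D unfolding joint_diagonalizer_def is_arg_min_linorder by auto
  have Dc: "D \<in> carrier_mat r r" using orthD unfolding orthogonal_matrix_def by auto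
  have finS: "finite S" using S finite_subset by blast
  \<comment> \<open>Conjugation by \<open>V\<close> only replaces \<open>L\<close> by
    \<open>V^T L\<close>, for the candidate minimizer and for \<open>D\<close> alike.\<close>
  have conj: "transpose_mat V * ?\<Sigma> n * V = (transpose_mat V * L) * diag_ind K (T n) * transpose_mat (transpose_mat V * L)"
    if V: "V \<in> carrier_mat r r" for V n
  proof -
    have "transpose_mat V * ?\<Sigma> n = transpose_mat V * (L * diag_ind K (T n)) * transpose_mat L"
      using V L by (intro assoc_mult_mat[symmetric, of _ r r _ K _ r]) auto
    also have "transpose_mat V * (L * diag_ind K (T n)) = transpose_mat V * L * diag_ind K (T n)"
      using V L by (intro assoc_mult_mat[symmetric, of _ r r _ K _ K]) auto
    finally have "transpose_mat V * ?\<Sigma> n * V = transpose_mat V * L * diag_ind K (T n) * transpose_mat L * V" by simp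
    also have "\<dots> = transpose_mat V * L * diag_ind K (T n) * (transpose_mat L * V)"
      using V L mult_carrier_mat[of "transpose_mat V * L" r K "diag_ind K (T n)" K]
      by (intro assoc_mult_mat[of _ r K _ r _ r]) auto
    also have "transpose_mat L * V = transpose_mat (transpose_mat V * L)"
      using V L by (simp add: transpose_mult[of _ r r _ K])
    finally show ?thesis .
  qed
  have conj_index: "(Y * diag_ind K T' * transpose_mat Y) $$ (i, j) = (\<Sum>k<K. Y $$ (i, k) * of_bool (k \<in> T') * Y $$ (j, k))"
    if Y: "Y \<in> carrier_mat r K" "i < r" "j < r" for Y T' i j
  proof -
    have YE: "Y * diag_ind K T' \<in> carrier_mat r K" using Y by auto
    show ?thesis using Y mult_diag_ind_index[OF Y(1,2), of _ T']
      by (subst index_mult_mat_sum[OF YE _ Y(2,3)]) auto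
  qed
  define es where "es = sorted_list_of_set S"
  have es: "length es = r" "distinct es" "set es = S" unfolding es_def using S finS by auto
  have esK: "es ! a < K" "es ! a \<in> S" if "a < r" for a using es S nth_mem[of a es] that by auto
  \<comment> \<open>The columns of \<open>L\<close> with index in \<open>S\<close> are orthonormal
    since \<open>L^T L\<close> is the indicator of \<open>S\<close>, and \<open>card S = r\<close>
    makes \<open>V\<close> square. The rows of \<open>V^T L\<close> are distinct unit vectors, so
    \<open>V\<close> attains the value 0 and the minimum is 0.\<close>
  define V where "V = mat r r (\<lambda>(i, a). L $$ (i, es ! a))"
  have V: "V \<in> carrier_mat r r" unfolding V_def by simp
  have VL: "(transpose_mat V * L) $$ (a, k) = (if es ! a = k then 1 else 0)" if "a < r" "k < K" for a k
  proof -
    have "(transpose_mat V * L) $$ (a, k) = (\<Sum>i<r. L $$ (i, es ! a) * L $$ (i, k))"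
      using V L that by (subst index_mult_mat_sum[of _ r r _ K]) (auto simp: V_def)
    also have "\<dots> = (transpose_mat L * L) $$ (es ! a, k)"
      using L that esK by (subst index_mult_mat_sum[of _ K r _ K]) auto
    finally show ?thesis using E that esK by (simp add: diag_ind_def)
  qed
  have "orthogonal_matrix r V"
    unfolding orthogonal_matrix_def
  proof (intro conjI V eq_matI)
    fix a b assume "a < dim_row (1\<^sub>m r :: real mat)" "b < dim_col (1\<^sub>m r :: real mat)"
    hence ab: "a < r" "b < r" by auto
    have "(transpose_mat V * V) $$ (a, b) = (transpose_mat V * L) $$ (a, es ! b)"
      using V L ab esK by (subst index_mult_mat_sum[of _ r r _ r])
        (auto simp: index_mult_mat_sum[of _ r r _ K] V_def simp del: index_mult_mat(1))
    thus "(transpose_mat V * V) $$ (a, b) = 1\<^sub>m r $$ (a, b)"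
      using VL[OF ab(1) esK(1)[OF ab(2)]] es ab by (simp add: nth_eq_iff_index_eq del: index_mult_mat(1))
  qed (use V in auto)
  moreover have "offdiag_sq (transpose_mat V * ?\<Sigma> n * V) = 0" for n
    unfolding offdiag_sq_eq_0_iff
  proof (intro allI impI)
    fix a b assume "a < dim_row (transpose_mat V * ?\<Sigma> n * V)" "b < dim_col (transpose_mat V * ?\<Sigma> n * V)" "a \<noteq> b"
    hence ab: "a < r" "b < r" "es ! a \<noteq> es ! b" using V es by (auto simp: nth_eq_iff_index_eq)
    have VLc: "transpose_mat V * L \<in> carrier_mat r K" using V L by auto
    show "(transpose_mat V * ?\<Sigma> n * V) $$ (a, b) = 0"
      unfolding conj[OF V] conj_index[OF VLc ab(1,2)]
      using VL ab by (intro sum.neutral) (auto simp del: index_mult_mat(1))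
  qed
  ultimately have "(\<Sum>n<M. offdiag_sq (transpose_mat D * ?\<Sigma> n * D)) \<le> 0" using min[of V] by simp
  hence "(\<Sum>n<M. offdiag_sq (transpose_mat D * ?\<Sigma> n * D)) = 0"
    by (rule order.antisym) (rule sum_nonneg, rule offdiag_sq_nonneg)
  hence off: "offdiag_sq (transpose_mat D * ?\<Sigma> n * D) = 0" if "n < M" for n
    using that offdiag_sq_nonneg by (subst (asm) sum_nonneg_eq_0_iff) auto
  show W: "W \<in> carrier_mat r K" unfolding W_def using Dc L by auto
  have WT: "transpose_mat W = transpose_mat L * D" unfolding W_def using Dc L by (simp add: transpose_mult[of _ r r _ K])
  have DDT: "D * transpose_mat D = 1\<^sub>m r" by (rule orthogonal_matrix_right[OF orthD])
  have DTD: "transpose_mat D * D = 1\<^sub>m r" using orthD unfolding orthogonal_matrix_def by auto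
  have "D * W = (D * transpose_mat D) * L"
    unfolding W_def using Dc L by (intro assoc_mult_mat[symmetric, of _ r r _ r _ K]) auto
  thus "D * W = L" using DDT L by simp
  have "transpose_mat W * W = transpose_mat L * (D * transpose_mat D) * L"
    unfolding WT unfolding W_def using Dc L by (intro assoc_mult_mat4[of _ K r _ r _ r _ K]) auto
  thus WW: "transpose_mat W * W = diag_ind K S" using DDT L E by simp
  have "W * transpose_mat W = transpose_mat D * (L * transpose_mat L) * D"
    unfolding WT unfolding W_def using Dc L by (intro assoc_mult_mat4[of _ r r _ K _ r _ r]) auto
  hence WWT: "W * transpose_mat W = 1\<^sub>m r" using LL DTD Dc by simp
  have WS: "W * diag_ind K S = W"
  proof -
    have "W * diag_ind K S = (W * transpose_mat W) * W"
      unfolding WW[symmetric] using W by (intro assoc_mult_mat[symmetric, of _ r K _ r _ K]) auto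
    thus ?thesis using WWT W by simp
  qed
  assume n: "n < M" and i: "i < r"
  let ?T = "diag_ind K (T n)" and ?Y = "W * diag_ind K (T n) * transpose_mat W"
  have Y: "?Y \<in> carrier_mat r r" using W by auto
  have Y0: "?Y $$ (i, j) = 0" if "j < r" "j \<noteq> i" for j
    using off[OF n] i that Y unfolding conj[OF Dc, folded W_def] offdiag_sq_eq_0_iff by auto
  \<comment> \<open>\<open>W^T W\<close> is the indicator of \<open>S\<close> and fixes
    \<open>W\<close> from the right, so it can be absorbed after commuting it past
    \<open>?T\<close>. As \<open>?Y\<close> is diagonal in row \<open>i\<close>, the resulting
    \<open>?Y * W = W * ?T\<close> is the eigenvector equation of that row, with eigenvalue
    \<open>?Y $$ (i, i)\<close>.\<close>
  have "?Y * W = W * ?T * (transpose_mat W * W)"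
    using W by (intro assoc_mult_mat[of _ r K _ r _ K]) auto
  also have "\<dots> = W * (diag_ind K S * ?T)"
    unfolding WW diag_ind_commute[of K S] using W by (intro assoc_mult_mat[of _ r K _ K _ K]) auto
  also have "\<dots> = W * diag_ind K S * ?T"
    using W by (intro assoc_mult_mat[symmetric, of _ r K _ K _ K]) auto
  finally have YW: "?Y * W = W * ?T" using WS by simp
  show "\<exists>d. \<forall>k<K. W $$ (i, k) * of_bool (k \<in> T n) = d * W $$ (i, k)"
  proof (intro exI allI impI)
    fix k assume k: "k < K"
    have "W $$ (i, k) * of_bool (k \<in> T n) = (?Y * W) $$ (i, k)"
      unfolding YW using mult_diag_ind_index[OF W i k] by simp
    also have "\<dots> = (\<Sum>j<r. ?Y $$ (i, j) * W $$ (j, k))" by (rule index_mult_mat_sum[OF Y W i k])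
    also have "\<dots> = (\<Sum>j\<in>{i}. ?Y $$ (i, j) * W $$ (j, k))"
      using Y0 i by (intro sum.mono_neutral_right) auto
    finally show "W $$ (i, k) * of_bool (k \<in> T n) = ?Y $$ (i, i) * W $$ (i, k)" by simp
  qed
qed

section \<open>Pivoted Cholesky factors and the output of the procedure\<close>

text \<open>Let \<open>E\<close> be the indicator of \<open>S\<close> and
  \<open>F = U^T E U\<close>. Then \<open>B F = W E U\<close>, and because rows of \<open>W\<close>
  are eigenvectors of \<open>E\<close>, each row of \<open>B F\<close> is a multiple of the same row
  of \<open>B\<close>. Once \<open>F\<close> is diagonal, each column of \<open>U\<close> is an
  eigenvector of \<open>E\<close> and so lies in or outside \<open>S\<close> entirely. The map
  \<open>p\<close> lists the rows of \<open>B\<close> in pivot order.\<close>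

lemma cholesky_columns_separate:
  assumes U: "orthogonal_matrix K U" and W: "W \<in> carrier_mat n K" and B: "B = W * U"
    and p: "\<And>i. i < K \<Longrightarrow> p i < n"
    and tri: "\<And>i j. i < j \<Longrightarrow> j < K \<Longrightarrow> B $$ (p i, j) = 0"
    and diag: "\<And>i. i < K \<Longrightarrow> B $$ (p i, i) \<noteq> 0"
    and W_eigen: "\<And>i. i < n \<Longrightarrow> \<exists>d. \<forall>k<K. W $$ (i, k) * of_bool (k \<in> S) = d * W $$ (i, k)"
    and nz: "k < K" "k' < K" "j < K" "U $$ (k, j) \<noteq> 0" "U $$ (k', j) \<noteq> 0"
  shows "k \<in> S \<longleftrightarrow> k' \<in> S"
proof -
  have Uc: "U \<in> carrier_mat K K" using U unfolding orthogonal_matrix_def by auto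
  define F where "F l j = (\<Sum>k<K. U $$ (k, l) * of_bool (k \<in> S) * U $$ (k, j))" for l j
  have sym: "F l j = F j l" for l j unfolding F_def by (simp add: mult.commute mult.left_commute)
  have UF: "(\<Sum>l<K. U $$ (k, l) * F l j) = of_bool (k \<in> S) * U $$ (k, j)" if k: "k < K" for k j
  proof -
    have "(\<Sum>l<K. U $$ (k, l) * F l j) = (\<Sum>l<K. \<Sum>k'<K. (U $$ (k, l) * U $$ (k', l)) * (of_bool (k' \<in> S) * U $$ (k', j)))"
      unfolding F_def by (simp add: sum_distrib_left mult.assoc)
    also have "\<dots> = (\<Sum>k'<K. \<Sum>l<K. (U $$ (k, l) * U $$ (k', l)) * (of_bool (k' \<in> S) * U $$ (k', j)))"
      by (rule sum.swap)
    also have "\<dots> = (\<Sum>k'<K. (if k = k' then 1 else 0) * (of_bool (k' \<in> S) * U $$ (k', j)))"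
      unfolding sum_distrib_right[symmetric]
      using orthogonal_matrix_row_sum[OF U k] by (intro sum.cong) auto
    also have "\<dots> = (\<Sum>k'<K. if k = k' then of_bool (k' \<in> S) * U $$ (k', j) else 0)"
      by (intro sum.cong) auto
    also have "\<dots> = of_bool (k \<in> S) * U $$ (k, j)" using k by simp
    finally show ?thesis .
  qed
  have Bi: "B $$ (i, j) = (\<Sum>k<K. W $$ (i, k) * U $$ (k, j))" if "i < n" "j < K" for i j
    unfolding B using index_mult_mat_sum[OF W Uc that] .
  have BF: "\<exists>d. (\<Sum>l<K. B $$ (i, l) * F l j) = d * B $$ (i, j)" if i: "i < n" and j: "j < K" for i j
  proof -
    obtain d where d: "\<forall>k<K. W $$ (i, k) * of_bool (k \<in> S) = d * W $$ (i, k)" using W_eigen[OF i] by blast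
    have "(\<Sum>l<K. B $$ (i, l) * F l j) = (\<Sum>l<K. \<Sum>k<K. W $$ (i, k) * (U $$ (k, l) * F l j))"
      using Bi[OF i] by (simp add: sum_distrib_right mult.assoc)
    also have "\<dots> = (\<Sum>k<K. \<Sum>l<K. W $$ (i, k) * (U $$ (k, l) * F l j))" by (rule sum.swap)
    also have "\<dots> = (\<Sum>k<K. W $$ (i, k) * of_bool (k \<in> S) * U $$ (k, j))"
      unfolding sum_distrib_left[symmetric] using UF by (intro sum.cong) (auto simp: mult.assoc)
    also have "\<dots> = d * B $$ (i, j)"
      unfolding Bi[OF i j] sum_distrib_left using d by (intro sum.cong) (auto simp: mult.assoc)
    finally show ?thesis by blast
  qed
  have upper: "F i j = 0" if "i < j" "j < K" for i j
    using that
  \<comment> \<open>Forward substitution along the pivots: in row \<open>p i\<close> of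
    \<open>B F\<close>, terms with \<open>l > i\<close> vanish by triangularity and those with
    \<open>l < i\<close> by induction. The remaining \<open>B $$ (p i, i) * F i j\<close> equals a
    multiple of \<open>B $$ (p i, j) = 0\<close>, and the pivot is nonzero.\<close>
  proof (induction i arbitrary: j rule: less_induct)
    case (less i)
    have i: "i < K" using less.prems by simp
    obtain d where "(\<Sum>l<K. B $$ (p i, l) * F l j) = d * B $$ (p i, j)" using BF[OF p[OF i] less.prems(2)] by blast
    hence "(\<Sum>l<K. B $$ (p i, l) * F l j) = 0" using tri[OF less.prems] by simp
    moreover have "(\<Sum>l<K. B $$ (p i, l) * F l j) = (\<Sum>l\<in>{i}. B $$ (p i, l) * F l j)"
    proof (rule sum.mono_neutral_right)
      show "\<forall>l\<in>{..<K} - {i}. B $$ (p i, l) * F l j = 0"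
      proof
        fix l assume "l \<in> {..<K} - {i}"
        then consider "l < i" | "i < l" "l < K" by fastforce
        thus "B $$ (p i, l) * F l j = 0"
          using less.IH[of l j] less.prems tri[of i l] by cases auto
      qed
    qed (use i in auto)
    ultimately show ?case using diag[OF i] by simp
  qed
  \<comment> \<open>This is \<open>U F = E U\<close> in column \<open>j\<close>, where symmetry of
    \<open>F\<close> leaves only the diagonal term.\<close>
  have "U $$ (k, j) * F j j = of_bool (k \<in> S) * U $$ (k, j)" if "k < K" for k
  proof -
    have "F l j = 0" if "l < K" "l \<noteq> j" for l
      using upper[of l j] upper[of j l] sym[of l j] that nz(3) by (cases "l < j") auto
    hence "(\<Sum>l<K. U $$ (k, l) * F l j) = (\<Sum>l\<in>{j}. U $$ (k, l) * F l j)"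
      using nz(3) by (intro sum.mono_neutral_right) auto
    moreover note UF[OF that, of j]
    ultimately show ?thesis by (cases "k \<in> S") simp_all
  qed
  from this[OF nz(1)] this[OF nz(2)] nz(4,5) have "F j j = of_bool (k \<in> S)" "F j j = of_bool (k' \<in> S)" by auto
  thus ?thesis by (simp add: of_bool_def split: if_splits)
qed

text \<open>The formula for the matrices \<open>\<Sigma>\<close> is available only for actual
  patches \<open>n < M\<close>, so they cannot be rewritten as functions of an arbitrary
  \<open>n\<close>.\<close>

lemma joint_diagonalizer_cong:
  assumes "\<And>n. n < M \<Longrightarrow> \<Sigma> n = \<Sigma>' n"
  shows "joint_diagonalizer k M \<Sigma> D \<longleftrightarrow> joint_diagonalizer k M \<Sigma>' D"
proof -
  have "(\<lambda>V. \<Sum>n<M. offdiag_sq (transpose_mat V * \<Sigma> n * V)) = (\<lambda>V. \<Sum>n<M. offdiag_sq (transpose_mat V * \<Sigma>' n * V))"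
    by (intro ext sum.cong) (simp_all add: assms)
  thus ?thesis unfolding joint_diagonalizer_def by simp
qed

lemma ismd_output_intrinsic_sparse_modes:
  assumes A: "A \<in> carrier_mat N N" and part: "patch_partition N Ps"
    and gd: "mode_decomposition A g" and reg: "regular_modes Ps g" and out: "ismd_output A Ps G"
  shows "intrinsic_sparse_modes A Ps G"
proof -
  define K where "K = vec_space.rank N A"
  define M where "M = length Ps"
  have dA: "dim_row A = N" using A by simp
  have g: "g \<in> carrier_mat N K" and Ag: "A = g * transpose_mat g"
    using gd unfolding mode_decomposition_def dA K_def by blast+
  \<comment> \<open>\<open>T\<close> is the triangular Cholesky factor; the letter \<open>L\<close>
    is kept for the coordinate blocks of the modes.\<close>
  obtain Hs Ds P T where
    Hs: "length Hs = M" and eig: "\<And>m. m < M \<Longrightarrow> eigen_factor (patch_block A Ps m m) (Hs ! m)" and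
    Ds: "length Ds = M" and
    jd: "\<And>m. m < M \<Longrightarrow> joint_diagonalizer (dim_col (Hs ! m)) M
           (\<lambda>n. Lambda_block A Ps Hs m n * transpose_mat (Lambda_block A Ps Hs m n)) (Ds ! m)" and
    chol: "pivoted_cholesky (transpose_mat (diag_block_mat Ds) * Lambda_mat A Ps Hs * diag_block_mat Ds) K P T" and
    G: "G \<in> carrier_mat N K" and
    GR: "rows_by_patch Ps G = diag_block_mat Hs * diag_block_mat Ds * P * T"
    using out unfolding ismd_output_def Let_def dA K_def M_def by blast
  define r where "r m = dim_col (Hs ! m)" for m
  define X where "X m = patch_rows g (Ps ! m)" for m
  define S where "S m = active_modes g (Ps ! m)" for m
  define L where "L m = left_pinv (Hs ! m) * X m" for m
  define W where "W m = transpose_mat (Ds ! m) * L m" for m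
  have Pm: "Ps ! m \<in> set Ps" if "m < M" for m using that unfolding M_def by simp
  have X: "X m \<in> carrier_mat (card (Ps ! m)) K" for m unfolding X_def using g by simp
  have block: "patch_block A Ps m n = X m * transpose_mat (X n)" if "m < M" "n < M" for m n
    using patch_block_gram[OF part g Ag] that unfolding X_def M_def by simp
  have dblock: "dim_row (patch_block A Ps m m) = card (Ps ! m)" if "m < M" for m
    using block[OF that that] X[of m] by simp
  note ef = eigen_factor_left_pinv[OF eig, unfolded r_def[symmetric]]
  have H: "Hs ! m \<in> carrier_mat (card (Ps ! m)) (r m)" and Z: "left_pinv (Hs ! m) \<in> carrier_mat (r m) (card (Ps ! m))"
    and ZH: "left_pinv (Hs ! m) * Hs ! m = 1\<^sub>m (r m)"
    and HH: "Hs ! m * transpose_mat (Hs ! m) = X m * transpose_mat (X m)" if "m < M" for m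
    using ef[OF that] block[OF that that] unfolding dblock[OF that] by (assumption | simp only:)+
  note pc = patch_coordinates[OF part Pm g reg HH[unfolded X_def] H Z ZH, folded X_def S_def, folded L_def]
  have L: "L m \<in> carrier_mat (r m) K" and HL: "Hs ! m * L m = X m" if "m < M" for m
    using pc[OF that that that that that] by auto
  have Lambda: "Lambda_block A Ps Hs m n = L m * transpose_mat (L n)" if mn: "m < M" "n < M" for m n
  proof -
    have "transpose_mat (L n) = transpose_mat (X n) * transpose_mat (left_pinv (Hs ! n))"
      unfolding L_def using Z[OF mn(2)] X[of n] by (simp add: transpose_mult)
    hence "L m * transpose_mat (L n) = left_pinv (Hs ! m) * (X m * transpose_mat (X n)) * transpose_mat (left_pinv (Hs ! n))"
      unfolding L_def using Z[OF mn(1)] Z[OF mn(2)] X[of n] X[of m]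
      by (simp add: assoc_mult_mat4[of _ "r m" "card (Ps ! m)" _ K _ "card (Ps ! n)" _ "r n"])
    thus ?thesis unfolding Lambda_block_def block[OF mn] by simp
  qed
  \<comment> \<open>\<open>\<Lambda>_mn = L_m L_n^T\<close>, so
    \<open>\<Lambda>_mn \<Lambda>_mn^T\<close> contains \<open>L_n^T L_n\<close>, the indicator of
    the modes active on patch \<open>n\<close>.\<close>
  have jd': "joint_diagonalizer (r m) M (\<lambda>n. L m * diag_ind K (S n) * transpose_mat (L m)) (Ds ! m)" if m: "m < M" for m
  proof -
    have "Lambda_block A Ps Hs m n * transpose_mat (Lambda_block A Ps Hs m n) = L m * diag_ind K (S n) * transpose_mat (L m)"
      if n: "n < M" for n
    proof -
      have "transpose_mat (L m * transpose_mat (L n)) = L n * transpose_mat (L m)"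
        using L[OF m] L[OF n] by (simp add: transpose_mult[of _ "r m" K _ "r n"])
      hence "Lambda_block A Ps Hs m n * transpose_mat (Lambda_block A Ps Hs m n) =
        L m * (transpose_mat (L n) * L n) * transpose_mat (L m)"
        unfolding Lambda[OF m n] using L[OF m] L[OF n]
        by (simp add: assoc_mult_mat4[of _ "r m" K _ "r n" _ K _ "r m"])
      thus ?thesis using pc(4)[OF n n n n n] by simp
    qed
    note sig = this
    have "joint_diagonalizer (r m) M (\<lambda>n. Lambda_block A Ps Hs m n * transpose_mat (Lambda_block A Ps Hs m n)) (Ds ! m) \<longleftrightarrow>
      joint_diagonalizer (r m) M (\<lambda>n. L m * diag_ind K (S n) * transpose_mat (L m)) (Ds ! m)"
      by (rule joint_diagonalizer_cong) (erule sig)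
    thus ?thesis using jd[OF m] unfolding r_def by blast
  qed
  have SK: "S m \<subseteq> {..<K}" for m unfolding S_def using active_modes_subset[OF g] .
  note js = joint_diagonalizer_separates[OF L pc(3) pc(4) SK pc(5) jd', folded W_def]
  have W: "W m \<in> carrier_mat (r m) K" and WtW_block: "transpose_mat (W m) * W m = diag_ind K (S m)" and DW: "Ds ! m * W m = L m"
    and Weig: "\<And>n i. n < M \<Longrightarrow> i < r m \<Longrightarrow> \<exists>d. \<forall>k<K. W m $$ (i, k) * of_bool (k \<in> S n) = d * W m $$ (i, k)"
    if "m < M" for m
    using js that by blast+
  have Dc: "Ds ! m \<in> carrier_mat (r m) (r m)" if "m < M" for m
    using jd[OF that] unfolding joint_diagonalizer_def is_arg_min_linorder orthogonal_matrix_def r_def by auto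
  define ks where "ks = map dim_col Hs"
  have ksM: "length ks = M" and ks: "\<And>m. m < M \<Longrightarrow> ks ! m = r m" unfolding ks_def r_def using Hs by auto
  have dDs: "map dim_col Ds = ks" "map dim_row Ds = ks"
    by (rule nth_equalityI; simp add: Ds ksM ks carrier_matD[OF Dc])+
  have dHs: "map dim_row Hs = map card Ps"
    by (rule nth_equalityI) (simp_all add: Hs carrier_matD[OF H] M_def[symmetric])
  define n where "n = sum_list ks"
  define WW where "WW = block_rows ks K W"
  define LL where "LL = block_rows ks K L"
  define D where "D = diag_block_mat Ds"
  define HE where "HE = diag_block_mat Hs"
  have c: "WW \<in> carrier_mat n K" "LL \<in> carrier_mat n K" "D \<in> carrier_mat n n" "HE \<in> carrier_mat (sum_list (map card Ps)) n"
    unfolding WW_def LL_def D_def HE_def n_def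
    by (auto intro!: carrier_matI simp: dim_diag_block_mat dDs dHs) (simp_all add: ks_def block_rows_def)
  have DWW: "D * WW = LL"
    unfolding D_def WW_def LL_def
    by (rule diag_block_mat_mult_block_rows[OF dDs(2,1)]) (simp_all add: Ds ks W DW)
  have DLL: "transpose_mat D * LL = WW"
  proof -
    have dims: "map dim_row (map transpose_mat Ds) = ks" "map dim_col (map transpose_mat Ds) = ks"
      unfolding map_map o_def index_transpose_mat by (rule dDs)+
    show ?thesis
      unfolding D_def WW_def LL_def diag_block_mat_transpose
      by (rule diag_block_mat_mult_block_rows[OF dims]) (simp_all add: Ds ks L W_def)
  qed
  have HLL: "HE * LL = rows_by_patch Ps g"
    unfolding HE_def LL_def rows_by_patch_eq[OF part g]
    by (rule diag_block_mat_mult_block_rows[OF dHs ks_def[symmetric]]) (simp_all add: Hs ks L HL X_def[symmetric])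
  have "Lambda_mat A Ps Hs = LL * transpose_mat LL"
  proof -
    have "block_matrix ks (Lambda_block A Ps Hs) = block_matrix ks (\<lambda>m n. L m * transpose_mat (L n))"
      unfolding block_matrix_def using block_indices_nth[of _ ks] Lambda ksM
      by (intro cong_mat) (auto split: prod.splits)
    also have "\<dots> = LL * transpose_mat LL"
      unfolding LL_def using L ks ksM by (intro block_rows_mult_transpose[symmetric]) auto
    finally show ?thesis unfolding Lambda_mat_def ks_def .
  qed
  have Omega: "transpose_mat D * Lambda_mat A Ps Hs * D = WW * transpose_mat WW"
  proof -
    have "transpose_mat WW = transpose_mat LL * D"
      unfolding DLL[symmetric] using c by (simp add: transpose_mult[of _ n n _ K])
    hence "WW * transpose_mat WW = (transpose_mat D * LL) * (transpose_mat LL * D)" using DLL by simp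
    also have "\<dots> = transpose_mat D * (LL * transpose_mat LL) * D"
      using c by (intro assoc_mult_mat4[of _ n n _ K _ n _ n]) auto
    finally show ?thesis using \<open>Lambda_mat A Ps Hs = LL * transpose_mat LL\<close> by simp
  qed
  have "dim_row (WW * transpose_mat WW) = n" using c by simp
  note chol' = chol[folded D_def, unfolded Omega pivoted_cholesky_def this]
  have perm: "permutation_matrix n P" and Tc: "T \<in> carrier_mat n K" and Kn: "K \<le> n"
    and Ttri: "\<And>i j. i < n \<Longrightarrow> j < K \<Longrightarrow> i < j \<Longrightarrow> T $$ (i, j) = 0" and Tdiag: "\<And>k. k < K \<Longrightarrow> T $$ (k, k) > 0"
    and PT: "WW * transpose_mat WW = P * T * transpose_mat T * transpose_mat P"
    using chol' by blast+
  obtain \<pi> where \<pi>: "\<pi> permutes {..<n}" and P_def: "P = mat n n (\<lambda>(i, j). if i = \<pi> j then 1 else 0)"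
    using perm unfolding permutation_matrix_def by blast
  have Pc: "P \<in> carrier_mat n n" unfolding P_def by simp
  define B where "B = P * T"
  have B: "B \<in> carrier_mat n K" unfolding B_def using Pc Tc by auto
  have BB: "WW * transpose_mat WW = B * transpose_mat B"
  proof -
    have "P * T * transpose_mat T * transpose_mat P = P * T * (transpose_mat T * transpose_mat P)"
      using Pc Tc by (intro assoc_mult_mat[of _ n K _ n _ n]) auto
    thus ?thesis unfolding PT B_def using Pc Tc by (simp add: transpose_mult)
  qed
  have \<pi>n: "\<pi> i < n" if "i < n" for i using permutes_in_image[OF \<pi>] that by auto
  \<comment> \<open>Row \<open>\<pi> i\<close> of the permuted factor is row \<open>i\<close> of
    \<open>T\<close>, so \<open>\<pi>\<close> is the pivot order in which the factor is
    triangular.\<close>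
  have B\<pi>: "B $$ (\<pi> i, j) = T $$ (i, j)" if "i < n" "j < K" for i j
  proof -
    have "B $$ (\<pi> i, j) = (\<Sum>l<n. P $$ (\<pi> i, l) * T $$ (l, j))"
      unfolding B_def by (rule index_mult_mat_sum[OF Pc Tc \<pi>n[OF that(1)] that(2)])
    also have "\<dots> = (\<Sum>l<n. if i = l then T $$ (l, j) else 0)"
      using \<pi>n[OF that(1)] permutes_inj[OF \<pi>] unfolding P_def by (intro sum.cong) (auto simp: inj_eq)
    finally show ?thesis using that by simp
  qed
  \<comment> \<open>The Gram matrix of the stack is the sum over patches of the indicators of active
    modes, hence diagonal with entries \<open>cnt k\<close>. These are positive because every mode
    is active somewhere, which provides the left inverse \<open>Y\<close> of
    \<open>WW\<close>.\<close>
  define cnt where "cnt k = card {m. m < M \<and> k \<in> S m}" for k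
  have cnt: "cnt k > 0" if k: "k < K" for k
  proof -
    have "k < dim_col g" using k g by simp
    then obtain P where "P \<in> set Ps" "k \<in> active_modes g P" using ex_active_patch[OF A part gd] by blast
    then obtain m where "m < M" "k \<in> S m" unfolding M_def S_def by (auto simp: in_set_conv_nth)
    thus ?thesis unfolding cnt_def by (auto simp: card_gt_0_iff)
  qed
  have WtW: "(transpose_mat WW * WW) $$ (k, l) = (if k = l then real (cnt k) else 0)" if kl: "k < K" "l < K" for k l
  proof -
    have "(transpose_mat WW * WW) $$ (k, l) = (\<Sum>m<M. (transpose_mat (W m) * W m) $$ (k, l))"
      using transpose_mult_block_rows[of ks W K k l] W ks ksM kl unfolding WW_def by auto
    also have "\<dots> = (\<Sum>m<M. if k = l \<and> k \<in> S m then 1 else 0)"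
      using WtW_block kl by (intro sum.cong) (auto simp: diag_ind_def)
    also have "\<dots> = (if k = l then real (cnt k) else 0)"
      unfolding cnt_def by (simp add: sum.If_cases Int_def)
    finally show ?thesis .
  qed
  define C where "C = mat K K (\<lambda>(k, l). if k = l then 1 / real (cnt k) else 0)"
  have Cc: "C \<in> carrier_mat K K" unfolding C_def by simp
  define Y where "Y = C * transpose_mat WW"
  have Y: "Y \<in> carrier_mat K n" unfolding Y_def using Cc c by auto
  have "C * (transpose_mat WW * WW) = 1\<^sub>m K"
  proof (rule eq_matI)
    fix k l assume "k < dim_row (1\<^sub>m K :: real mat)" "l < dim_col (1\<^sub>m K :: real mat)"
    hence kl: "k < K" "l < K" by auto
    have "(C * (transpose_mat WW * WW)) $$ (k, l) = (\<Sum>j<K. C $$ (k, j) * (transpose_mat WW * WW) $$ (j, l))"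
      using c by (intro index_mult_mat_sum[OF Cc _ kl]) auto
    also have "\<dots> = (\<Sum>j<K. if j = k then (if j = l then 1 else 0) else 0)"
    proof (rule sum.cong)
      fix j assume "j \<in> {..<K}"
      hence j: "j < K" by simp
      show "C $$ (k, j) * (transpose_mat WW * WW) $$ (j, l) = (if j = k then (if j = l then 1 else 0) else 0)"
        unfolding WtW[OF j kl(2)] using kl j cnt[OF j] unfolding C_def by auto
    qed simp
    finally show "(C * (transpose_mat WW * WW)) $$ (k, l) = 1\<^sub>m K $$ (k, l)" using kl by simp
  qed (use Cc c in auto)
  hence YW: "Y * WW = 1\<^sub>m K"
    unfolding Y_def using c Cc by (subst assoc_mult_mat[of _ K K _ n _ K]) auto
  define U where "U = Y * B"
  have WU: "WW * U = B" and UU: "U * transpose_mat U = 1\<^sub>m K"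
    using gram_eq_left_inverse[OF c(1) B Y YW BB] unfolding U_def by auto
  have Uc: "U \<in> carrier_mat K K" unfolding U_def using Y B by auto
  have Uo: "orthogonal_matrix K U"
    using orthogonal_matrix_transpose[of K "transpose_mat U"] Uc UU unfolding orthogonal_matrix_def by auto
  \<comment> \<open>In the patch ordering \<open>H_ext D P T = H_ext D W U = H_ext L U\<close>, and
    \<open>H_ext L\<close> is the reordered \<open>g\<close>; here \<open>W\<close> and
    \<open>L\<close> are the stacks \<open>WW\<close> and \<open>LL\<close>.\<close>
  have Gg: "G = g * U"
  proof (rule rows_by_patch_inj[OF part G])
    show "g * U \<in> carrier_mat N K" using g Uc by auto
    have "rows_by_patch Ps G = HE * D * (P * T)"
      unfolding GR HE_def[symmetric] D_def[symmetric] using c Pc Tc by (intro assoc_mult_mat[of _ "sum_list (map card Ps)" n _ n _ K]) auto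
    also have "\<dots> = HE * (D * B)"
      unfolding B_def[symmetric] using c B by (intro assoc_mult_mat[of _ "sum_list (map card Ps)" n _ n _ K]) auto
    also have "D * B = D * WW * U"
      unfolding WU[symmetric] using c Uc by (intro assoc_mult_mat[symmetric, of _ n n _ K _ K]) auto
    also have "HE * (D * WW * U) = HE * LL * U"
      unfolding DWW using c Uc by (intro assoc_mult_mat[symmetric, of _ "sum_list (map card Ps)" n _ K _ K]) auto
    also have "\<dots> = rows_by_patch Ps (g * U)" unfolding HLL using rows_by_patch_mult[OF part g Uc] by simp
    finally show "rows_by_patch Ps G = rows_by_patch Ps (g * U)" .
  qed
  have sep: "k \<in> S m \<longleftrightarrow> k' \<in> S m"
    if m: "m < M" and nz: "k < K" "k' < K" "j < K" "U $$ (k, j) \<noteq> 0" "U $$ (k', j) \<noteq> 0" for m k k' j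
  proof (rule cholesky_columns_separate[OF Uo c(1) WU[symmetric], where p = \<pi>])
    show "\<exists>d. \<forall>k<K. WW $$ (i, k) * of_bool (k \<in> S m) = d * WW $$ (i, k)" if i: "i < n" for i
    proof -
      obtain m' a where idx: "block_indices ks ! i = (m', a)" by fastforce
      have ma: "m' < M" "a < r m'" using block_indices_nth[OF i[unfolded n_def] idx] ksM ks by auto
      show ?thesis using Weig[OF ma(1) m ma(2)] block_rows_index[OF i[unfolded n_def] idx] unfolding WW_def by simp
    qed
    show "B $$ (\<pi> i, j) = 0" if "i < j" "j < K" for i j
      using B\<pi>[of i j] Ttri[of i j] that Kn by auto
    show "B $$ (\<pi> i, i) \<noteq> 0" if "i < K" for i
      using B\<pi>[of i i] Tdiag[of i] that Kn by auto
    show "\<pi> i < n" if "i < K" for i using \<pi>n that Kn by auto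
  qed (use nz in auto)
  show ?thesis
  proof (rule intrinsic_sparse_modesI[OF A part gd reg])
    have "G * transpose_mat G = g * (U * transpose_mat U) * transpose_mat g"
      unfolding Gg using g Uc by (simp add: transpose_mult[OF g Uc] assoc_mult_mat4[of _ N K _ K _ K _ N])
    thus "mode_decomposition A G" unfolding mode_decomposition_def dA K_def[symmetric] using G g UU Ag by simp
    fix P assume P: "P \<in> set Ps"
    then obtain m where m: "m < M" "P = Ps ! m" unfolding M_def by (auto simp: in_set_conv_nth)
    have "card (active_modes G P) \<le> card (active_modes g P)"
    \<comment> \<open>Counting with \<open>U^T\<close> reverses the general inequality. A mode
      \<open>j\<close> of \<open>G\<close> active on \<open>P\<close> uses some active mode
      \<open>k'\<close> of \<open>g\<close>; since column \<open>j\<close> of \<open>U\<close> does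
      not mix active and inactive modes, it vanishes at every inactive \<open>k\<close>.\<close>
    proof (rule orthogonal_matrix_zero_block(1)[OF orthogonal_matrix_transpose[OF Uo] active_modes_subset[OF G] active_modes_subset[OF g]])
      fix j k assume j: "j \<in> active_modes G P" and k: "k < K" "k \<notin> active_modes g P"
      have jK: "j < K" using j active_modes_subset[OF G] by auto
      obtain a where a: "a < card P" "G $$ (pick P a, j) \<noteq> 0" using notin_active_modes[OF part P G jK] j by auto
      have "(\<Sum>k<K. g $$ (pick P a, k) * U $$ (k, j)) \<noteq> 0"
        using a index_mult_mat_sum[OF g Uc pick_less[OF part P a(1)] jK] unfolding Gg by simp
      then obtain k' where k': "k' < K" "g $$ (pick P a, k') * U $$ (k', j) \<noteq> 0"
        by (meson lessThan_iff sum.neutral)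
      hence "k' \<in> active_modes g P" using notin_active_modes[OF part P g k'(1)] a(1) by auto
      thus "transpose_mat U $$ (j, k) = 0"
        using sep[OF m(1) k(1) k'(1) jK] k k' jK Uc unfolding S_def m(2)[symmetric] by auto
    qed
    thus "card (active_modes G P) \<le> card (active_modes g P)" .
  qed
qed

section \<open>Rotations within groups of unidentifiable modes\<close>

lemma hconcat_index:
  assumes "\<And>q. q < length Bs \<Longrightarrow> dim_row (Bs ! q) = N" "i < N" "j < sum_list (map dim_col Bs)"
    "block_indices (map dim_col Bs) ! j = (q, a)"
  shows "hconcat N Bs $$ (i, j) = (Bs ! q) $$ (i, a)"
proof -
  have "map cols Bs = map (\<lambda>q. map (col (Bs ! q)) [0..<dim_col (Bs ! q)]) [0..<length Bs]"
    by (rule nth_equalityI) (auto simp: cols_def)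
  hence "concat (map cols Bs) = map (\<lambda>(q, a). col (Bs ! q) a) (block_indices (map dim_col Bs))"
    unfolding block_indices_def by (simp add: map_concat o_def) (rule arg_cong[where f = concat], auto)
  thus ?thesis unfolding hconcat_def using assms block_indices_nth[OF assms(3,4)]
    by (simp add: mat_of_cols_index)
qed

lemma hconcat_carrier: "hconcat N Bs \<in> carrier_mat N (sum_list (map dim_col Bs))"
  unfolding hconcat_def by (intro carrier_matI) (simp_all add: length_concat o_def)

text \<open>\<open>U\<close> is block diagonal up to a permutation of its columns: group
  \<open>q\<close> occupies the rows \<open>R q\<close> and touches only the columns
  \<open>J q\<close>. Both sets have \<open>n_q\<close> elements, so the block on \<open>R q\<close>
  and \<open>J q\<close> is square and inherits orthonormal rows; it serves as
  \<open>U_q\<close>.\<close>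

lemma group_rotation_exists:
  assumes row: "\<And>q. q < length \<Psi>s \<Longrightarrow> dim_row (\<Psi>s ! q) = N" and gr: "grouped_modes N Ps \<Psi>s"
    and \<Psi>: "\<Psi> = hconcat N \<Psi>s" "\<Psi> \<in> carrier_mat N K"
    and U: "orthogonal_matrix K U" and \<Phi>: "\<Phi> = \<Psi> * U"
    and supp: "\<And>k j. k < K \<Longrightarrow> j < K \<Longrightarrow> U $$ (k, j) \<noteq> 0 \<Longrightarrow>
      patch_support Ps (col \<Psi> k) = patch_support Ps (col \<Phi> j)"
  shows "\<exists>Us \<pi>. group_rotations \<Psi>s Us \<and> \<pi> permutes {..<K} \<and> permute_cols \<pi> \<Phi> = rotate_groups N \<Psi>s Us"
proof -
  define ns where "ns = map dim_col \<Psi>s"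
  define idx where "idx i = block_indices ns ! i" for i
  have K: "sum_list ns = K" using \<Psi> hconcat_carrier[of N \<Psi>s] unfolding ns_def by auto
  have Uc: "U \<in> carrier_mat K K" using U unfolding orthogonal_matrix_def by auto
  have UT: "orthogonal_matrix K (transpose_mat U)" by (rule orthogonal_matrix_transpose[OF U])
  have idxD: "q < length \<Psi>s \<and> a < ns ! q" if "i < K" "idx i = (q, a)" for i q a
    using block_indices_nth[of i ns q a] that K unfolding idx_def ns_def by auto
  have idx_inj: "i = j" if "i < K" "j < K" "idx i = idx j" for i j
    using block_indices_inj[of i ns j] that K unfolding idx_def by simp
  have "\<exists>i. i < K \<and> idx i = (q, a)" if "q < length \<Psi>s" "a < ns ! q" for q a
    using ex_block_index[of q ns a] that K unfolding idx_def ns_def by auto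
  then obtain pos where pos: "\<And>q a. q < length \<Psi>s \<Longrightarrow> a < ns ! q \<Longrightarrow> pos q a < K \<and> idx (pos q a) = (q, a)"
    by metis
  have \<Psi>_index: "\<Psi> $$ (i, k) = (\<Psi>s ! q) $$ (i, a)" if "i < N" "k < K" "idx k = (q, a)" for i k q a
    unfolding \<Psi>(1) using hconcat_index[OF row, of i k q a] that K unfolding idx_def ns_def by simp
  have col\<Psi>: "col \<Psi> k = col (\<Psi>s ! q) a" if "k < K" "idx k = (q, a)" for k q a
    using \<Psi>_index[OF _ that] idxD[OF that] row[of q] \<Psi>(2) that(1) unfolding ns_def by (intro eq_vecI) auto
  have same_group: "fst (idx k) = fst (idx k')" if "k < K" "k' < K" "patch_support Ps (col \<Psi> k) = patch_support Ps (col \<Psi> k')" for k k'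
  proof -
    obtain q a q' a' where i: "idx k = (q, a)" "idx k' = (q', a')" by fastforce
    have "unidentifiable Ps (col (\<Psi>s ! q) a) (col (\<Psi>s ! q') a')"
      using that col\<Psi> i unfolding unidentifiable_def by metis
    hence "q = q'" using gr idxD[OF that(1) i(1)] idxD[OF that(2) i(2)] unfolding grouped_modes_def ns_def by auto
    thus ?thesis using i by simp
  qed
  define R where "R q = {k. k < K \<and> fst (idx k) = q}" for q
  define J where "J q = {j. j < K \<and> (\<exists>k\<in>R q. U $$ (k, j) \<noteq> 0)}" for q
  have RK: "R q \<subseteq> {..<K}" and JK: "J q \<subseteq> {..<K}" for q unfolding R_def J_def by auto
  have z1: "U $$ (k, j) = 0" if "k \<in> R q" "j < K" "j \<notin> J q" for q k j using that unfolding J_def by auto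
  \<comment> \<open>All modes of \<open>\<Psi>\<close> used by column \<open>j\<close> share the
    support of mode \<open>j\<close> of \<open>\<Phi>\<close>, so a column cannot touch two
    groups.\<close>
  have z2: "U $$ (k, j) = 0" if j: "j \<in> J q" and k: "k < K" "k \<notin> R q" for q k j
  proof (rule ccontr)
    assume nz: "U $$ (k, j) \<noteq> 0"
    obtain k' where k': "k' \<in> R q" "U $$ (k', j) \<noteq> 0" "j < K" using j unfolding J_def by auto
    hence "patch_support Ps (col \<Psi> k) = patch_support Ps (col \<Psi> k')"
      using supp[of k j] supp[of k' j] nz k RK[of q] by auto
    thus False using same_group[of k k'] k' k unfolding R_def by auto
  qed
  have R_eq: "R q = pos q ` {0..<ns ! q}" if q: "q < length \<Psi>s" for q
  proof
    show "pos q ` {0..<ns ! q} \<subseteq> R q" using pos[OF q] unfolding R_def by auto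
    show "R q \<subseteq> pos q ` {0..<ns ! q}"
    proof
      fix k assume "k \<in> R q"
      then obtain a where k: "k < K" "idx k = (q, a)" unfolding R_def by (cases "idx k") auto
      hence a: "a < ns ! q" using idxD by blast
      hence "k = pos q a" using pos[OF q a] k idx_inj by metis
      thus "k \<in> pos q ` {0..<ns ! q}" using a by auto
    qed
  qed
  have pos_inj: "inj_on (pos q) {0..<ns ! q}" if q: "q < length \<Psi>s" for q
    by (rule inj_onI) (use pos[OF q] in \<open>metis atLeastLessThan_iff prod.inject\<close>)
  have cardR: "card (R q) = ns ! q" if "q < length \<Psi>s" for q
    unfolding R_eq[OF that] card_image[OF pos_inj[OF that]] by simp
  \<comment> \<open>The block on \<open>R q\<close> and \<open>J q\<close> is isolated in its rows
    by \<open>z1\<close> and in its columns by \<open>z2\<close>; counting with \<open>U\<close> and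
    with \<open>U^T\<close> gives the two inequalities.\<close>
  have cardJ: "card (J q) = ns ! q" if "q < length \<Psi>s" for q
  proof -
    have "card (R q) \<le> card (J q)"
      by (rule orthogonal_matrix_zero_block(1)[OF U RK JK]) (rule z1)
    moreover have "card (J q) \<le> card (R q)"
      by (rule orthogonal_matrix_zero_block(1)[OF UT JK RK]) (use z2[of _ q] Uc JK[of q] in auto)
    ultimately show ?thesis using cardR[OF that] by simp
  qed
  have "\<exists>e. bij_betw e {0..<ns ! q} (J q)" if "q < length \<Psi>s" for q
    using ex_bij_betw_nat_finite[of "J q"] finite_subset[OF JK[of q]] cardJ[OF that] by auto
  then obtain e where e: "\<And>q. q < length \<Psi>s \<Longrightarrow> bij_betw (e q) {0..<ns ! q} (J q)" by metis
  have eJ: "e q a \<in> J q" if "q < length \<Psi>s" "a < ns ! q" for q a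
    using bij_betwE[OF e[OF that(1)]] that by auto
  \<comment> \<open>Position \<open>(q, a)\<close> of the grouped ordering receives the
    \<open>a\<close>-th column of \<open>J q\<close> in an arbitrary enumeration \<open>e q\<close>.
    Injectivity rests on the sets \<open>J q\<close> being disjoint, which follows from
    \<open>z2\<close>.\<close>
  define \<pi> where "\<pi> i = (if i < K then case idx i of (q, a) \<Rightarrow> e q a else i)" for i
  have \<pi>_eq: "\<pi> i = e q a" if "i < K" "idx i = (q, a)" for i q a using that unfolding \<pi>_def by simp
  have inj: "inj_on \<pi> {..<K}"
  proof (rule inj_onI)
    fix i i' assume i: "i \<in> {..<K}" "i' \<in> {..<K}" and eq: "\<pi> i = \<pi> i'"
    obtain q a q' a' where x: "idx i = (q, a)" "idx i' = (q', a')" by fastforce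
    have q: "q < length \<Psi>s" "a < ns ! q" "q' < length \<Psi>s" "a' < ns ! q'" using idxD i x by auto
    have ee: "e q a = e q' a'" using eq \<pi>_eq i x by auto
    hence "e q a \<in> J q" "e q a \<in> J q'" using eJ q by metis+
    then obtain k where "k < K" "fst (idx k) = q" "U $$ (k, e q a) \<noteq> 0" "e q a \<in> J q'"
      unfolding J_def R_def by auto
    hence "q = q'" using z2[of "e q a" q' k] unfolding R_def by auto
    moreover have "a = a'" using inj_onD[OF bij_betw_imp_inj_on[OF e[OF q(1)]], of a a'] ee q \<open>q = q'\<close> by auto
    ultimately show "i = i'" using idx_inj x i by auto
  qed
  have "\<pi> ` {..<K} \<subseteq> {..<K}"
  proof
    fix x assume "x \<in> \<pi> ` {..<K}"
    then obtain i where i: "i < K" "x = \<pi> i" by auto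
    obtain q a where qa: "idx i = (q, a)" by fastforce
    thus "x \<in> {..<K}" using eJ[of q a] idxD[OF i(1) qa] JK[of q] \<pi>_eq[OF i(1) qa] i by auto
  qed
  hence "bij_betw \<pi> {..<K} {..<K}" unfolding bij_betw_def using inj endo_inj_surj[of "{..<K}" \<pi>] by auto
  hence perm: "\<pi> permutes {..<K}" by (rule bij_imp_permutes) (auto simp: \<pi>_def)
  define Us where "Us = map (\<lambda>q. mat (ns ! q) (ns ! q) (\<lambda>(a, b). U $$ (pos q a, e q b))) [0..<length \<Psi>s]"
  have Us: "Us ! q = mat (ns ! q) (ns ! q) (\<lambda>(a, b). U $$ (pos q a, e q b))" if "q < length \<Psi>s" for q
    unfolding Us_def using that by simp
  have "group_rotations \<Psi>s Us"
    unfolding group_rotations_def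
  proof (intro conjI allI impI)
    show "length Us = length \<Psi>s" unfolding Us_def by simp
    fix q assume q: "q < length \<Psi>s"
    have nsq: "dim_col (\<Psi>s ! q) = ns ! q" unfolding ns_def using q by simp
    show "orthogonal_matrix (dim_col (\<Psi>s ! q)) (Us ! q)"
      unfolding nsq
    proof (rule orthogonal_matrixI)
      show "Us ! q \<in> carrier_mat (ns ! q) (ns ! q)" unfolding Us[OF q] by simp
      fix a a' assume a: "a < ns ! q" "a' < ns ! q"
      have "(\<Sum>b<ns ! q. Us ! q $$ (a, b) * Us ! q $$ (a', b)) = (\<Sum>b\<in>{0..<ns ! q}. U $$ (pos q a, e q b) * U $$ (pos q a', e q b))"
        unfolding Us[OF q] using a by (intro sum.cong) auto
      also have "\<dots> = (\<Sum>j\<in>J q. U $$ (pos q a, j) * U $$ (pos q a', j))"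
        by (rule sum.reindex_bij_betw[OF e[OF q]])
      also have "\<dots> = (\<Sum>j<K. U $$ (pos q a, j) * U $$ (pos q a', j))"
        using z1[of "pos q a" q] R_eq[OF q] a by (intro sum.mono_neutral_left JK) auto
      also have "\<dots> = (if pos q a = pos q a' then 1 else 0)"
        using pos[OF q] a by (intro orthogonal_matrix_row_sum[OF U]) auto
      finally show "(\<Sum>b<ns ! q. Us ! q $$ (a, b) * Us ! q $$ (a', b)) = (if a = a' then 1 else 0)"
        using inj_onD[OF pos_inj[OF q], of a a'] a by auto
    qed
  qed
  moreover have "permute_cols \<pi> \<Phi> = rotate_groups N \<Psi>s Us"
  proof (rule eq_matI)
    let ?Bs = "map2 (*) \<Psi>s Us"
    have lUs: "length Us = length \<Psi>s" unfolding Us_def by simp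
    have dims: "map dim_col ?Bs = ns"
      by (rule nth_equalityI) (auto simp: lUs ns_def Us)
    have rows: "dim_row (?Bs ! q) = N" if "q < length ?Bs" for q using that row lUs by simp
    have rg: "rotate_groups N \<Psi>s Us \<in> carrier_mat N K"
      unfolding rotate_groups_def using hconcat_carrier[of N ?Bs] unfolding dims K .
    have \<Phi>c: "\<Phi> \<in> carrier_mat N K" unfolding \<Phi> using \<Psi>(2) Uc by auto
    show "dim_row (permute_cols \<pi> \<Phi>) = dim_row (rotate_groups N \<Psi>s Us)"
      "dim_col (permute_cols \<pi> \<Phi>) = dim_col (rotate_groups N \<Psi>s Us)"
      using rg \<Phi>c unfolding permute_cols_def by auto
    fix i j assume "i < dim_row (rotate_groups N \<Psi>s Us)" "j < dim_col (rotate_groups N \<Psi>s Us)"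
    hence i: "i < N" and j: "j < K" using rg by auto
    obtain q b where x: "idx j = (q, b)" by fastforce
    have q: "q < length \<Psi>s" and b: "b < ns ! q" using idxD[OF j x] by auto
    have \<Psi>q: "\<Psi>s ! q \<in> carrier_mat N (ns ! q)" using row[OF q] q unfolding ns_def by auto
    have \<pi>j: "\<pi> j \<in> J q" "\<pi> j = e q b" using \<pi>_eq[OF j x] eJ[OF q b] by auto
    have "permute_cols \<pi> \<Phi> $$ (i, j) = \<Phi> $$ (i, \<pi> j)"
      unfolding permute_cols_def using i j \<Phi>c by simp
    also have "\<dots> = (\<Sum>k<K. \<Psi> $$ (i, k) * U $$ (k, \<pi> j))"
      unfolding \<Phi> using \<pi>j JK[of q] by (intro index_mult_mat_sum[OF \<Psi>(2) Uc i]) auto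
    also have "\<dots> = (\<Sum>k\<in>R q. \<Psi> $$ (i, k) * U $$ (k, \<pi> j))"
      using z2[OF \<pi>j(1)] by (intro sum.mono_neutral_right RK) auto
    also have "\<dots> = (\<Sum>a\<in>{0..<ns ! q}. \<Psi> $$ (i, pos q a) * U $$ (pos q a, \<pi> j))"
      unfolding R_eq[OF q] by (subst sum.reindex[OF pos_inj[OF q]]) simp
    also have "\<dots> = (\<Sum>a<ns ! q. (\<Psi>s ! q) $$ (i, a) * (Us ! q) $$ (a, b))"
      using pos[OF q] \<Psi>_index[OF i] b unfolding Us[OF q] \<pi>j(2) by (intro sum.cong) auto
    also have "\<dots> = (\<Psi>s ! q * Us ! q) $$ (i, b)"
      by (rule index_mult_mat_sum[symmetric, OF \<Psi>q _ i b]) (simp add: Us[OF q])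
    also have "\<dots> = (?Bs ! q) $$ (i, b)" using q lUs by simp
    also have "\<dots> = rotate_groups N \<Psi>s Us $$ (i, j)"
      unfolding rotate_groups_def using hconcat_index[OF rows i, of j q b] j x unfolding dims K idx_def by simp
    finally show "permute_cols \<pi> \<Phi> $$ (i, j) = rotate_groups N \<Psi>s Us $$ (i, j)" .
  qed
  ultimately show ?thesis using perm by blast
qed

lemma grouping_exists:
  assumes \<Psi>: "\<Psi> \<in> carrier_mat N K"
  shows "\<exists>\<sigma> \<Psi>s. \<sigma> permutes {..<K} \<and> permute_cols \<sigma> \<Psi> = hconcat N \<Psi>s \<and> grouped_modes N Ps \<Psi>s"
proof -
  define f where "f k = patch_support Ps (col \<Psi> k)" for k
  \<comment> \<open>Only supports that occur are listed, since \<open>grouped_modes\<close> demands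
    nonempty groups.\<close>
  obtain ss where ss: "set ss = f ` {..<K}" "distinct ss" using finite_distinct_list[of "f ` {..<K}"] by auto
  define js where "js s = filter (\<lambda>k. f k = s) [0..<K]" for s
  define \<Psi>s where "\<Psi>s = map (\<lambda>s. mat_of_cols N (map (col \<Psi>) (js s))) ss"
  define all where "all = concat (map js ss)"
  have set_js: "set (js s) = {k. k < K \<and> f k = s}" for s unfolding js_def by auto
  have dist: "distinct all"
    unfolding all_def
  proof (rule distinct_concat)
    have "inj_on js (set ss)"
    proof (rule inj_onI)
      fix s s' assume s: "s \<in> set ss" "s' \<in> set ss" "js s = js s'"
      obtain k where "k < K" "f k = s" using s(1) ss by auto
      hence "k \<in> set (js s')" unfolding s(3)[symmetric] set_js by simp
      thus "s = s'" using \<open>f k = s\<close> unfolding set_js by simp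
    qed
    thus "distinct (map js ss)" using ss by (simp add: distinct_map)
    fix ys zs assume "ys \<in> set (map js ss)" "zs \<in> set (map js ss)" "ys \<noteq> zs"
    then obtain s s' where "ys = js s" "zs = js s'" "s \<noteq> s'" by auto
    thus "set ys \<inter> set zs = {}" using set_js by auto
  qed (auto simp: js_def)
  have set_all: "set all = {..<K}" unfolding all_def using ss set_js by auto
  have len: "length all = K" using distinct_card[OF dist] set_all by simp
  define \<sigma> where "\<sigma> i = (if i < K then all ! i else i)" for i
  have "bij_betw (nth all) {..<K} {..<K}"
    by (rule bij_betw_nth) (use dist set_all len in auto)
  hence "bij_betw \<sigma> {..<K} {..<K}" by (rule bij_betw_cong[THEN iffD1, rotated]) (simp add: \<sigma>_def)
  hence perm: "\<sigma> permutes {..<K}" by (rule bij_imp_permutes) (auto simp: \<sigma>_def)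
  have carr: "set (map (col \<Psi>) xs) \<subseteq> carrier_vec N" for xs using \<Psi> by auto
  have "concat (map cols \<Psi>s) = map (col \<Psi>) all"
    unfolding \<Psi>s_def all_def map_map o_def cols_mat_of_cols[OF carr] by (simp add: map_concat o_def)
  hence "permute_cols \<sigma> \<Psi> = hconcat N \<Psi>s"
    unfolding hconcat_def permute_cols_def using \<Psi> len set_all nth_mem[of _ all]
    by (intro eq_matI) (auto simp: mat_of_cols_index \<sigma>_def)
  moreover have "grouped_modes N Ps \<Psi>s"
  proof -
    have dims: "dim_row (\<Psi>s ! q) = N" "dim_col (\<Psi>s ! q) = length (js (ss ! q))" if "q < length ss" for q
      unfolding \<Psi>s_def using that by auto
    have pos: "length (js (ss ! q)) > 0" if "q < length ss" for q
    proof -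
      have "ss ! q \<in> f ` {..<K}" using nth_mem[OF that] unfolding ss(1) .
      then obtain k where "k \<in> set (js (ss ! q))" unfolding set_js by auto
      thus ?thesis by (auto simp: length_greater_0_conv)
    qed
    have supp: "patch_support Ps (col (\<Psi>s ! q) j) = ss ! q" if q: "q < length ss" and j: "j < length (js (ss ! q))" for q j
    proof -
      have mem: "js (ss ! q) ! j \<in> set (js (ss ! q))" using j by simp
      have c: "col \<Psi> k \<in> carrier_vec N" for k using \<Psi> by auto
      have "col (\<Psi>s ! q) j = col \<Psi> (js (ss ! q) ! j)"
        using q j c[of "js (ss ! q) ! j"] unfolding \<Psi>s_def by (simp add: col_mat_of_cols)
      thus ?thesis using mem unfolding set_js f_def by simp
    qed
    show ?thesis
      unfolding grouped_modes_def unidentifiable_def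
      using dims pos supp ss(2) by (auto simp: \<Psi>s_def nth_eq_iff_index_eq)
  qed
  ultimately show ?thesis using perm by blast
qed

text \<open>Once the output \<open>G\<close> is known to be a minimizer, its relation to
  \<open>\<Psi>\<close> is an instance of uniqueness between two minimizers, with the given grouping
  and hence the identity ordering. For two arbitrary families a grouping of the first has to be
  produced by sorting its columns.\<close>

theorem theorem3p1:
  fixes A :: "real mat" and N K :: nat and Ps :: "nat set list"
  assumes A: "A \<in> carrier_mat N N"
    and psd: "sym_psd A"
    and rank: "vec_space.rank N A = K"
    and partition: "patch_partition N Ps"
    and regular: "regular_sparse A Ps"
  shows
    "(\<forall>G. ismd_output A Ps G \<longrightarrow>
        (\<forall>\<Psi>s. intrinsic_sparse_modes A Ps (hconcat N \<Psi>s) \<and> grouped_modes N Ps \<Psi>s \<longrightarrow>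
           (\<exists>Us \<pi>. group_rotations \<Psi>s Us \<and> \<pi> permutes {..<K} \<and>
              permute_cols \<pi> G = rotate_groups N \<Psi>s Us)) \<and>
        intrinsic_sparse_modes A Ps G) \<and>
     (\<forall>\<Psi> \<Phi>. intrinsic_sparse_modes A Ps \<Psi> \<and> intrinsic_sparse_modes A Ps \<Phi> \<longrightarrow>
        (\<exists>\<sigma> \<pi> \<Psi>s Us. \<sigma> permutes {..<K} \<and> \<pi> permutes {..<K} \<and>
           permute_cols \<sigma> \<Psi> = hconcat N \<Psi>s \<and> grouped_modes N Ps \<Psi>s \<and>
           group_rotations \<Psi>s Us \<and> permute_cols \<pi> \<Phi> = rotate_groups N \<Psi>s Us))"
proof -
  obtain g where g: "mode_decomposition A g" and li: "\<forall>P \<in> set Ps. lin_indpt_family (card P)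
        (filter (\<lambda>v. v \<noteq> 0\<^sub>v (card P)) (map (\<lambda>\<psi>. restrict_vec \<psi> P) (cols g)))"
    using regular unfolding regular_sparse_def by blast
  have carrier: "h \<in> carrier_mat N K" if "mode_decomposition A h" for h
    using that A rank unfolding mode_decomposition_def by auto
  have ismd: "intrinsic_sparse_modes A Ps G" if "ismd_output A Ps G" for G
    using ismd_output_intrinsic_sparse_modes[OF A partition g _ that]
      regular_sparse_imp_regular_modes[OF partition carrier[OF g] li] by blast
  have modes: "h \<in> carrier_mat N K" if "intrinsic_sparse_modes A Ps h" for h
    using that carrier unfolding intrinsic_sparse_modes_def is_arg_min_linorder by blast
  have rotate: "\<exists>Us \<pi>. group_rotations \<Psi>s Us \<and> \<pi> permutes {..<K} \<and> permute_cols \<pi> \<Phi> = rotate_groups N \<Psi>s Us"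
    if \<Psi>: "intrinsic_sparse_modes A Ps \<Psi>" and \<Phi>: "intrinsic_sparse_modes A Ps \<Phi>"
      and \<sigma>: "\<sigma> permutes {..<K}" "permute_cols \<sigma> \<Psi> = hconcat N \<Psi>s" and gr: "grouped_modes N Ps \<Psi>s"
    for \<Psi> \<Phi> \<sigma> \<Psi>s
  proof -
    obtain U where U: "orthogonal_matrix K U" "\<Phi> = \<Psi> * U"
      "\<And>k j. k < K \<Longrightarrow> j < K \<Longrightarrow> U $$ (k, j) \<noteq> 0 \<Longrightarrow> patch_support Ps (col \<Psi> k) = patch_support Ps (col \<Phi> j)"
      using intrinsic_sparse_modes_rotation[OF A partition regular \<Psi> \<Phi> rank[symmetric]] by blast
    have Uc: "U \<in> carrier_mat K K" using U(1) unfolding orthogonal_matrix_def by auto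
    have \<Psi>c: "\<Psi> \<in> carrier_mat N K" by (rule modes[OF \<Psi>])
    have \<sigma>K: "\<sigma> k < K" if "k < K" for k using permutes_in_image[OF \<sigma>(1)] that by auto
    let ?\<Psi> = "permute_cols \<sigma> \<Psi>"
    \<comment> \<open>Permuting the columns of \<open>\<Psi>\<close> by \<open>\<sigma>\<close> is
      compensated by the same permutation of the rows of \<open>U\<close>, which leaves the product
      \<open>\<Phi>\<close> unchanged.\<close>
    let ?U = "mat K K (\<lambda>(i, j). U $$ (\<sigma> i, j))"
    have \<Psi>'c: "?\<Psi> \<in> carrier_mat N K" using \<Psi>c unfolding permute_cols_def by auto
    have U': "orthogonal_matrix K ?U"
    proof (rule orthogonal_matrixI)
      fix i j assume ij: "i < K" "j < K"
      have "(\<Sum>k<K. ?U $$ (i, k) * ?U $$ (j, k)) = (if \<sigma> i = \<sigma> j then 1 else 0)"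
        using orthogonal_matrix_row_sum[OF U(1) \<sigma>K[OF ij(1)] \<sigma>K[OF ij(2)]] ij by simp
      thus "(\<Sum>k<K. ?U $$ (i, k) * ?U $$ (j, k)) = (if i = j then 1 else 0)"
        using permutes_inj[OF \<sigma>(1)] by (simp add: inj_eq)
    qed simp
    have \<Phi>': "\<Phi> = ?\<Psi> * ?U"
    proof (rule eq_matI)
      fix i j assume "i < dim_row (?\<Psi> * ?U)" "j < dim_col (?\<Psi> * ?U)"
      hence ij: "i < N" "j < K" using \<Psi>'c by auto
      have "\<Phi> $$ (i, j) = (\<Sum>k<K. \<Psi> $$ (i, k) * U $$ (k, j))"
        unfolding U(2) by (rule index_mult_mat_sum[OF \<Psi>c Uc ij])
      also have "\<dots> = (\<Sum>k<K. \<Psi> $$ (i, \<sigma> k) * U $$ (\<sigma> k, j))"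
        using sum.permute[OF \<sigma>(1), of "\<lambda>k. \<Psi> $$ (i, k) * U $$ (k, j)"] by simp
      also have "\<dots> = (\<Sum>k<K. ?\<Psi> $$ (i, k) * ?U $$ (k, j))"
        using \<Psi>c ij unfolding permute_cols_def by (intro sum.cong) auto
      also have "\<dots> = (?\<Psi> * ?U) $$ (i, j)"
        using \<Psi>'c ij by (intro index_mult_mat_sum[symmetric]) auto
      finally show "\<Phi> $$ (i, j) = (?\<Psi> * ?U) $$ (i, j)" .
    qed (use modes[OF \<Phi>] \<Psi>'c in auto)
    show ?thesis
    proof (rule group_rotation_exists[OF _ gr \<sigma>(2) \<Psi>'c U' \<Phi>'])
      show "dim_row (\<Psi>s ! q) = N" if "q < length \<Psi>s" for q
        using gr that unfolding grouped_modes_def by blast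
      fix k j assume kj: "k < K" "j < K" "?U $$ (k, j) \<noteq> 0"
      have "col ?\<Psi> k = col \<Psi> (\<sigma> k)"
        using \<Psi>c kj \<sigma>K[OF kj(1)] unfolding permute_cols_def by (intro eq_vecI) auto
      thus "patch_support Ps (col ?\<Psi> k) = patch_support Ps (col \<Phi> j)"
        using U(3)[OF \<sigma>K[OF kj(1)] kj(2)] kj by simp
    qed
  qed
  have id: "permute_cols id B = B" for B :: "real mat"
    unfolding permute_cols_def by (intro eq_matI) auto
  show ?thesis
  proof (intro conjI allI impI)
    fix G \<Psi>s assume G: "ismd_output A Ps G"
      and \<Psi>s: "intrinsic_sparse_modes A Ps (hconcat N \<Psi>s) \<and> grouped_modes N Ps \<Psi>s"
    show "\<exists>Us \<pi>. group_rotations \<Psi>s Us \<and> \<pi> permutes {..<K} \<and> permute_cols \<pi> G = rotate_groups N \<Psi>s Us"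
      using rotate[OF _ ismd[OF G] permutes_id id] \<Psi>s by blast
  next
    fix G assume "ismd_output A Ps G"
    thus "intrinsic_sparse_modes A Ps G" by (rule ismd)
  next
    fix \<Psi> \<Phi> assume *: "intrinsic_sparse_modes A Ps \<Psi> \<and> intrinsic_sparse_modes A Ps \<Phi>"
    obtain \<sigma> \<Psi>s where \<sigma>: "\<sigma> permutes {..<K}" "permute_cols \<sigma> \<Psi> = hconcat N \<Psi>s" "grouped_modes N Ps \<Psi>s"
      using grouping_exists[OF modes] * by blast
    thus "\<exists>\<sigma> \<pi> \<Psi>s Us. \<sigma> permutes {..<K} \<and> \<pi> permutes {..<K} \<and>
           permute_cols \<sigma> \<Psi> = hconcat N \<Psi>s \<and> grouped_modes N Ps \<Psi>s \<and>
           group_rotations \<Psi>s Us \<and> permute_cols \<pi> \<Phi> = rotate_groups N \<Psi>s Us"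
      using rotate[OF conjunct1[OF *] conjunct2[OF *] \<sigma>] by blast
  qed
qed

end
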